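(* Let $n,k,s$ be positive integers with $k\geq 2$, $s\geq 2$ and $n\geq sk$. Then $$\chi_{l}\left(KG^{2}(n,k)_{\widetilde{s\text{-}stab}}\right)\geq \left\lceil \frac{n-s(k-1)}{2}\right\rceil +1.$$
   Context: A $k$-subset $S\subseteq[n]$ is almost $s$-stable if $|i-j|\geq s$ for all distinct $i,j\in S$. The almost $s$-stable Kneser graph $KG^{2}(n,k)_{\widetilde{s\text{-}stab}}$ has as vertices the almost $s$-stable $k$-subsets of $[n]$, two vertices being adjacent iff they are disjoint. For a graph $G=(V,E)$, the closed neighborhood of $u$ is $N[u]=\{u\}\cup\{v: uv\in E\}$, and the local chromatic number is $\chi_l(G)=\min_c\max_{v\in V}|c(N[v])|$, the minimum taken over all proper colorings $c$ of $G$. *)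

theory Defs
  imports Complex_Main
begin

text \<open>A simple graph is a pair (V, E), where an edge is an unordered pair of distinct vertices,
  i.e. a two-element subset of V.\<close>

type_synonym 'a graph = "'a set \<times> 'a set set"

definition verts :: "'a graph \<Rightarrow> 'a set" where
  "verts G = fst G"

definition edges :: "'a graph \<Rightarrow> 'a set set" where
  "edges G = snd G"

definition simple_graph :: "'a graph \<Rightarrow> bool" where
  "simple_graph G \<longleftrightarrow> (\<forall>e\<in>edges G. e \<subseteq> verts G \<and> card e = 2)"

definition closed_neighborhood :: "'a graph \<Rightarrow> 'a \<Rightarrow> 'a set" where
  "closed_neighborhood G u = {u} \<union> {v \<in> verts G. {u, v} \<in> edges G}"

definition proper_coloring :: "'a graph \<Rightarrow> ('a \<Rightarrow> nat) \<Rightarrow> bool" where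
  "proper_coloring G c \<longleftrightarrow>
     (\<forall>u\<in>verts G. \<forall>v\<in>verts G. {u, v} \<in> edges G \<longrightarrow> c u \<noteq> c v)"

text \<open>Intended for finite nonempty simple graphs: the maximum then exists, the minimum is over a
  nonempty set, and restricting to colors in the natural numbers loses nothing, since the finitely
  many colors that occur can be renumbered.  The number of colors is not bounded.\<close>

definition local_chromatic_number :: "'a graph \<Rightarrow> nat" where
  "local_chromatic_number G =
     (LEAST m. \<exists>c. proper_coloring G c \<and>
        m = Max ((\<lambda>v. card (c ` closed_neighborhood G v)) ` verts G))"

definition almost_stable :: "nat \<Rightarrow> nat set \<Rightarrow> bool" where
  "almost_stable s S \<longleftrightarrow> (\<forall>i\<in>S. \<forall>j\<in>S. i \<noteq> j \<longrightarrow> \<bar>int i - int j\<bar> \<ge> int s)"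

definition almost_stable_subsets :: "nat \<Rightarrow> nat \<Rightarrow> nat \<Rightarrow> nat set set" where
  "almost_stable_subsets n k s = {S. S \<subseteq> {1..n} \<and> card S = k \<and> almost_stable s S}"

definition almost_stable_kneser_graph :: "nat \<Rightarrow> nat \<Rightarrow> nat \<Rightarrow> nat set graph" where
  "almost_stable_kneser_graph n k s =
     (almost_stable_subsets n k s,
      {{S, T} | S T. S \<in> almost_stable_subsets n k s \<and> T \<in> almost_stable_subsets n k s \<and>
                     S \<inter> T = {}})"

lemma finite_verts_almost_stable_kneser_graph:
  "finite (verts (almost_stable_kneser_graph n k s))"
proof -
  have "almost_stable_subsets n k s \<subseteq> Pow {1..n}"
    by (auto simp: almost_stable_subsets_def)
  then show ?thesis
    by (auto simp: almost_stable_kneser_graph_def verts_def intro: finite_subset)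
qed

lemma simple_graph_almost_stable_kneser_graph:
  assumes "k \<ge> 1"
  shows "simple_graph (almost_stable_kneser_graph n k s)"
proof -
  have "card {S, T} = 2"
    if "S \<in> almost_stable_subsets n k s" "S \<inter> T = {}" for S T
  proof -
    have "S \<noteq> {}" using that assms by (auto simp: almost_stable_subsets_def)
    then have "S \<noteq> T" using that by auto
    then show ?thesis by simp
  qed
  then show ?thesis
    by (auto simp: simple_graph_def almost_stable_kneser_graph_def verts_def edges_def)
qed

lemma edges_almost_stable_kneser_graph_iff:
  assumes "S \<in> verts (almost_stable_kneser_graph n k s)"
    and "T \<in> verts (almost_stable_kneser_graph n k s)"
  shows "{S, T} \<in> edges (almost_stable_kneser_graph n k s) \<longleftrightarrow> S \<inter> T = {}"
  using assms
  by (auto simp: almost_stable_kneser_graph_def verts_def edges_def doubleton_eq_iff)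

lemma proper_coloring_exists:
  assumes "finite (verts G)" "simple_graph G"
  shows "\<exists>c. proper_coloring G c"
proof -
  obtain c :: "'a \<Rightarrow> nat" where c: "inj_on c (verts G)"
    using finite_imp_inj_to_nat_seg[OF assms(1)] by blast
  have "c u \<noteq> c v" if "u \<in> verts G" "v \<in> verts G" "{u, v} \<in> edges G" for u v
  proof -
    have "card {u, v} = 2" using assms(2) that by (auto simp: simple_graph_def)
    then have "u \<noteq> v" by auto
    then show ?thesis using c that by (auto simp: inj_on_def)
  qed
  then show ?thesis by (auto simp: proper_coloring_def)
qed

lemma local_chromatic_number_attained:
  assumes "finite (verts G)" "simple_graph G"
  obtains c where "proper_coloring G c"
    "local_chromatic_number G = Max ((\<lambda>v. card (c ` closed_neighborhood G v)) ` verts G)"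
proof -
  let ?P = "\<lambda>m. \<exists>c. proper_coloring G c \<and>
        m = Max ((\<lambda>v. card (c ` closed_neighborhood G v)) ` verts G)"
  have "\<exists>m. ?P m" using proper_coloring_exists[OF assms] by blast
  then have "?P (LEAST m. ?P m)" by (rule LeastI_ex)
  then show thesis using that unfolding local_chromatic_number_def by blast
qed

lemma local_chromatic_number_le:
  assumes "proper_coloring G c"
  shows "local_chromatic_number G \<le> Max ((\<lambda>v. card (c ` closed_neighborhood G v)) ` verts G)"
  unfolding local_chromatic_number_def using assms by (intro Least_le) blast

lemma verts_almost_stable_kneser_graph_nonempty:
  assumes "s \<ge> 1" and "n \<ge> s * k"
  shows "verts (almost_stable_kneser_graph n k s) \<noteq> {}"
proof -
  let ?S = "(\<lambda>i. s * i) ` {1..k}"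
  have sub: "?S \<subseteq> {1..n}"
  proof
    fix x assume "x \<in> ?S"
    then obtain i where i: "x = s * i" "1 \<le> i" "i \<le> k" by (meson atLeastAtMost_iff imageE)
    have "s * i \<le> s * k" using i by simp
    moreover have "1 \<le> s * i" using i assms by (simp add: Suc_leI)
    ultimately show "x \<in> {1..n}"
      using i(1) assms(2) by (metis atLeastAtMost_iff order_trans)
  qed
  have "card ?S = k"
    using assms by (subst card_image) (auto simp: inj_on_def)
  moreover have "almost_stable s ?S"
    unfolding almost_stable_def
  proof (intro ballI impI)
    fix x y assume "x \<in> ?S" "y \<in> ?S" "x \<noteq> y"
    then obtain i j where ij: "x = s * i" "y = s * j" "i \<noteq> j" by blast
    have eq: "\<bar>int x - int y\<bar> = int s * \<bar>int i - int j\<bar>"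
      using ij by (simp add: abs_mult flip: right_diff_distrib)
    have "int s * 1 \<le> int s * \<bar>int i - int j\<bar>"
      using ij by (intro mult_left_mono) auto
    with eq show "int s \<le> \<bar>int x - int y\<bar>" by simp
  qed
  ultimately have "?S \<in> almost_stable_subsets n k s"
    using sub by (simp add: almost_stable_subsets_def)
  then show ?thesis
    by (auto simp: almost_stable_kneser_graph_def verts_def)
qed

end

theory Submission imports Defs begin

text \<open>Write \<open>m = s * (k - 1)\<close> and \<open>t = n - m\<close>.  Sign vectors on \<open>{1..n}\<close> are labelled
  antipodally by nonzero integers so that no two comparable ones have opposite labels.  If the
  positive or the negative part contains a vertex of the graph, the absolute value of the label is
  \<open>m + 1\<close> plus the largest color of such a vertex, and the sign tells in which part it lies;
  all other sign vectors get labels of absolute value at most \<open>m\<close>.  By Ky Fan's lemma some maximal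
  chain carries \<open>n\<close> labels that alternate in sign when ordered by absolute value.  At least \<open>t\<close> of
  them exceed \<open>m\<close>, and they yield a completely multicolored complete bipartite subgraph with sides
  of sizes differing by at most one.  A vertex of one side sees the colors of the other, and its
  own.

  For even \<open>s\<close> the length and the first sign of a longest alternating subsequence would do as
  small labels.  For odd \<open>s\<close> this fails: \<open>s + 1\<close> consecutive alternating signs need not contain
  two equal signs at distance at least \<open>s\<close>.  The sets of first elements of the largest
  stable sets of either sign then have to be compared, in the extreme case by the parity of
  their elements.\<close>

section \<open>Parity and alternating sets of integers\<close>

text \<open>Discarding one orbit \<open>{x, f x}\<close> leaves a smaller set that \<open>f\<close>
  still pairs off.\<close>

lemma even_card_involution:
  assumes "finite E" and "\<And>x. x \<in> E \<Longrightarrow> f x \<in> E \<and> f x \<noteq> x \<and> f (f x) = x"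
  shows "even (card E)"
  using assms
proof (induction "card E" arbitrary: E rule: less_induct)
  case less
  show ?case
  proof (cases "E = {}")
    case False
    then obtain x where x: "x \<in> E" by blast
    let ?F = "E - {x, f x}"
    have fx: "f x \<in> E" "f x \<noteq> x" "f (f x) = x" using less.prems x by auto
    have c: "card E = Suc (Suc (card ?F))"
      using less.prems(1) x fx
      by (metis Diff_insert card_Suc_Diff1 finite_Diff insertE insert_Diff)
    have "even (card ?F)"
    proof (rule less.hyps)
      show "card ?F < card E" using c by simp
      show "finite ?F" using less.prems by simp
      fix y assume y: "y \<in> ?F"
      then have "f y \<in> E" "f y \<noteq> y" "f (f y) = y" using less.prems by auto
      moreover have "f y \<noteq> x" "f y \<noteq> f x" using y fx calculation by auto
      ultimately show "f y \<in> ?F \<and> f y \<noteq> y \<and> f (f y) = y" by simp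
    qed
    then show ?thesis using c by simp
  qed simp
qed

text \<open>The cardinality is the rank of \<open>v\<close> by absolute value, so no sorted list is
  needed; \<open>e\<close> tells whether the element of smallest absolute value is positive.\<close>

definition alternating :: "bool \<Rightarrow> int set \<Rightarrow> bool" where
  "alternating e L \<longleftrightarrow> (\<forall>v\<in>L. v > 0 \<longleftrightarrow> (even (card {w \<in> L. \<bar>w\<bar> < \<bar>v\<bar>}) \<longleftrightarrow> e))"

lemma alternating_empty [simp]: "alternating e {}"
  by (simp add: alternating_def)

text \<open>A new element of smallest absolute value raises every other rank by one, which flips the
  parity and hence the sign expected in first place.\<close>

lemma alternating_insert:
  assumes "finite L" "\<And>w. w \<in> L \<Longrightarrow> \<bar>a\<bar> < \<bar>w\<bar>"
  shows "alternating e (insert a L) \<longleftrightarrow> (a > 0 \<longleftrightarrow> e) \<and> alternating (\<not> e) L"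
proof -
  have 1: "{w \<in> insert a L. \<bar>w\<bar> < \<bar>a\<bar>} = {}"
    using assms(2) by fastforce
  have 2: "card {w \<in> insert a L. \<bar>w\<bar> < \<bar>v\<bar>} = Suc (card {w \<in> L. \<bar>w\<bar> < \<bar>v\<bar>})" if "v \<in> L" for v
  proof -
    have "{w \<in> insert a L. \<bar>w\<bar> < \<bar>v\<bar>} = insert a {w \<in> L. \<bar>w\<bar> < \<bar>v\<bar>}"
      using assms(2) that by auto
    moreover have "a \<notin> L" using assms(2) by blast
    ultimately show ?thesis using assms(1) by simp
  qed
  show ?thesis
    unfolding alternating_def ball_simps(7) 1 using 2 by auto
qed

text \<open>The induction adds elements at the low end, the form that
  \<open>alternating_insert\<close> can use.\<close>

lemma finite_abs_induct [consumes 2, case_names empty insert]: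
  fixes L :: "int set"
  assumes "finite L" "inj_on abs L" and "P {}"
    and "\<And>a L. finite L \<Longrightarrow> inj_on abs L \<Longrightarrow> (\<And>w. w \<in> L \<Longrightarrow> \<bar>a\<bar> < \<bar>w\<bar>) \<Longrightarrow> P L \<Longrightarrow> P (insert a L)"
  shows "P L"
  using assms(1,2)
proof (induction "card L" arbitrary: L)
  case 0
  then show ?case using assms(3) by simp
next
  case (Suc m)
  then have "L \<noteq> {}" by auto
  then obtain a where a: "a \<in> L" "\<And>w. w \<in> L \<Longrightarrow> \<bar>a\<bar> \<le> \<bar>w\<bar>"
    using Suc.prems by (metis arg_min_if_finite(1) arg_min_least)
  have "P (insert a (L - {a}))"
  proof (rule assms(4))
    show "finite (L - {a})" "inj_on abs (L - {a})" using Suc.prems by (auto intro: inj_on_subset)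
    then show "P (L - {a})" using Suc a by simp
    show "\<bar>a\<bar> < \<bar>w\<bar>" if "w \<in> L - {a}" for w
      using that a Suc.prems(2) by (metis Diff_iff inj_onD insertI1 order_le_less)
  qed
  then show ?case using a by (simp add: insert_absorb)
qed

text \<open>This later gives the sizes of the two sides of the multicolored bipartite
  subgraph.\<close>

lemma card_pos_alternating:
  assumes "finite L" "inj_on abs L" "alternating e L"
  shows "card {v \<in> L. v > 0} = (if e then Suc (card L) div 2 else card L div 2)"
  using assms
proof (induction L arbitrary: e rule: finite_abs_induct)
  case (insert a L)
  have aL: "a \<notin> L" using insert.hyps by blast
  have ih: "card {v \<in> L. v > 0} = (if \<not> e then Suc (card L) div 2 else card L div 2)"
    and s: "a > 0 \<longleftrightarrow> e"
    using insert alternating_insert[of L a e] by auto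
  have "{v \<in> insert a L. v > 0} = (if e then insert a {v \<in> L. v > 0} else {v \<in> L. v > 0})"
    using s by auto
  then show ?case using ih aL insert.hyps by simp
qed simp

lemma alternating_not_both:
  assumes "L \<noteq> {}" "alternating e L" "alternating (\<not> e) L"
  shows False
  using assms unfolding alternating_def by blast

lemma alternating_uminus:
  assumes "0 \<notin> L"
  shows "alternating e (uminus ` L) \<longleftrightarrow> alternating (\<not> e) L"
proof -
  have "card {w \<in> uminus ` L. \<bar>w\<bar> < \<bar>- v\<bar>} = card {w \<in> L. \<bar>w\<bar> < \<bar>v\<bar>}" for v :: int
  proof -
    have "{w \<in> uminus ` L. \<bar>w\<bar> < \<bar>- v\<bar>} = uminus ` {w \<in> L. \<bar>w\<bar> < \<bar>v\<bar>}" by auto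
    then show ?thesis by (simp add: card_image)
  qed
  moreover have "- v > 0 \<longleftrightarrow> \<not> v > 0" if "v \<in> L" for v
  proof -
    have "v \<noteq> 0" using assms that by metis
    then show ?thesis by linarith
  qed
  ultimately show ?thesis unfolding alternating_def by auto
qed

text \<open>Let \<open>a\<close> be smallest. Deleting \<open>a\<close> leaves \<open>L\<close>;
  deleting another element is admissible only if \<open>a\<close> has sign \<open>e\<close>, and
  then the rest is a deletion from \<open>L\<close> with first sign \<open>\<not> e\<close>. Modulo
  2, the case that \<open>L\<close> alternates with first sign \<open>e\<close> is counted twice if
  \<open>a\<close> has sign \<open>e\<close>, and once otherwise.\<close>

lemma odd_card_alternating_deletions:
  assumes "finite L" "inj_on abs L" "L \<noteq> {}"
  shows "odd (card {v \<in> L. alternating e (L - {v})}) \<longleftrightarrow> alternating e L \<or> alternating (\<not> e) L"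
  using assms
proof (induction L arbitrary: e rule: finite_abs_induct)
  case (insert a L)
  note fin = insert.hyps(1) and small = insert.hyps(3)
  have aL: "a \<notin> L" using small by blast
  let ?D = "\<lambda>e. {v \<in> L. alternating e (L - {v})}"
  have del: "alternating e (insert a L - {v}) \<longleftrightarrow> (a > 0 \<longleftrightarrow> e) \<and> alternating (\<not> e) (L - {v})"
    if "v \<in> L" for v
  proof -
    have "insert a L - {v} = insert a (L - {v})" using aL that by auto
    then show ?thesis using alternating_insert[of "L - {v}" a e] fin small by simp
  qed
  have D: "{v \<in> insert a L. alternating e (insert a L - {v})} =
      (if alternating e L then {a} else {}) \<union> (if a > 0 \<longleftrightarrow> e then ?D (\<not> e) else {})"
  proof (rule set_eqI)
    fix v
    have "insert a L - {a} = L" using aL by auto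
    then show "v \<in> {v \<in> insert a L. alternating e (insert a L - {v})} \<longleftrightarrow>
      v \<in> (if alternating e L then {a} else {}) \<union> (if a > 0 \<longleftrightarrow> e then ?D (\<not> e) else {})"
      using del[of v] aL by (cases "v = a") auto
  qed
  have c: "card {v \<in> insert a L. alternating e (insert a L - {v})} =
      (if alternating e L then 1 else 0) + (if a > 0 \<longleftrightarrow> e then card (?D (\<not> e)) else 0)"
    unfolding D using aL fin by (subst card_Un_disjoint) auto
  show ?case
  \<comment> \<open>The induction hypothesis does not cover the empty set, which alternates with
    both first signs.\<close>
  proof (cases "L = {}")
    case True
    then show ?thesis unfolding c using alternating_insert[of "{}" a] by auto
  next
    case False
    have ih: "odd (card (?D (\<not> e))) \<longleftrightarrow> alternating (\<not> e) L \<or> alternating e L"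
      using insert.IH[of "\<not> e"] False by simp
    have "\<not> (alternating e L \<and> alternating (\<not> e) L)" using alternating_not_both False by blast
    then show ?thesis
      unfolding c using ih alternating_insert[of L a e] alternating_insert[of L a "\<not> e"] fin small
      by auto
  qed
qed simp

section \<open>Ky Fan's lemma for the cross-polytope\<close>

text \<open>A nonzero sign vector is encoded by its signed support: \<open>i\<close> for a plus and
  \<open>- i\<close> for a minus at position \<open>i\<close>. Inclusion is then the order of sign
  vectors, and negation is the image under \<open>uminus\<close>.\<close>

definition signed_set :: "nat \<Rightarrow> int set \<Rightarrow> bool" where
  "signed_set n x \<longleftrightarrow> x \<noteq> {} \<and> abs ` x \<subseteq> {1..int n} \<and> (\<forall>i\<in>x. - i \<notin> x)"

text \<open>The signed permutation \<open>\<sigma>\<close> encodes the maximal chain of the signed sets \<open>set (take j \<sigma>)\<close>,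
  that is, a facet of the barycentric subdivision of the boundary of the cross-polytope.\<close>

definition flags :: "nat \<Rightarrow> int list set" where
  "flags d = {\<sigma>. distinct (map abs \<sigma>) \<and> abs ` set \<sigma> = {1..int d}}"

lemma length_flags: "\<sigma> \<in> flags d \<Longrightarrow> length \<sigma> = d"
  using distinct_card[of "map abs \<sigma>"] by (simp add: flags_def)

lemma finite_flags: "finite (flags d)"
proof (rule finite_subset)
  show "flags d \<subseteq> {\<sigma>. set \<sigma> \<subseteq> {- int d..int d} \<and> length \<sigma> = d}"
  proof
    fix \<sigma> assume s: "\<sigma> \<in> flags d"
    have "x \<in> {- int d..int d}" if "x \<in> set \<sigma>" for x
    proof -
      have "\<bar>x\<bar> \<in> {1..int d}" using s that unfolding flags_def by blast
      then show ?thesis by auto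
    qed
    then show "\<sigma> \<in> {\<sigma>. set \<sigma> \<subseteq> {- int d..int d} \<and> length \<sigma> = d}"
      using length_flags[OF s] by auto
  qed
qed (simp add: finite_lists_length_eq)

lemma flags_uminus: "\<sigma> \<in> flags d \<Longrightarrow> map uminus \<sigma> \<in> flags d"
  by (simp add: flags_def image_image comp_def)

lemma flags_nonzero: "\<sigma> \<in> flags d \<Longrightarrow> i \<in> set \<sigma> \<Longrightarrow> i \<noteq> 0"
  unfolding flags_def by (auto dest!: equalityD1)

lemma flags_uminus_notin: "\<sigma> \<in> flags d \<Longrightarrow> i \<in> set \<sigma> \<Longrightarrow> - i \<notin> set \<sigma>"
proof
  assume s: "\<sigma> \<in> flags d" "i \<in> set \<sigma>" "- i \<in> set \<sigma>"
  then have "inj_on abs (set \<sigma>)" by (simp add: flags_def distinct_map)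
  then have "i = - i" using s by (metis abs_minus_cancel inj_onD)
  then show False using flags_nonzero[OF s(1,2)] by simp
qed

text \<open>The last set of a maximal chain has full support, so the sign of coordinate
  \<open>d\<close> decides on which side of the equator the chain lies.\<close>

lemma flags_iff_mem:
  assumes "\<sigma> \<in> flags d" "d \<ge> 1"
  shows "- int d \<in> set \<sigma> \<longleftrightarrow> int d \<notin> set \<sigma>"
proof -
  have "int d \<in> abs ` set \<sigma>" using assms by (simp add: flags_def)
  then have "int d \<in> set \<sigma> \<or> - int d \<in> set \<sigma>" by (auto simp: abs_if split: if_splits)
  then show ?thesis using flags_uminus_notin[OF assms(1)] by auto
qed

lemma signed_set_take:
  assumes "\<sigma> \<in> flags d" "d \<le> n" "1 \<le> j" "j \<le> d"
  shows "signed_set n (set (take j \<sigma>))"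
proof -
  have sub: "set (take j \<sigma>) \<subseteq> set \<sigma>" by (rule set_take_subset)
  then have "abs ` set (take j \<sigma>) \<subseteq> {1..int d}" using assms(1) by (auto simp: flags_def)
  moreover have "set (take j \<sigma>) \<noteq> {}" using assms length_flags[OF assms(1)] by auto
  ultimately show ?thesis
    using flags_uminus_notin[OF assms(1)] sub assms(2) unfolding signed_set_def by fastforce
qed

text \<open>Maximal chains on \<open>d\<close> coordinates are the equatorial faces one dimension
  higher: coordinate \<open>Suc d\<close> enters only at the last step.\<close>

lemma flags_snoc:
  "\<sigma> @ [int (Suc d)] \<in> flags (Suc d) \<longleftrightarrow> \<sigma> \<in> flags d"
proof
  assume a: "\<sigma> @ [int (Suc d)] \<in> flags (Suc d)"
  have "int (Suc d) \<notin> abs ` set \<sigma>" using a by (simp add: flags_def)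
  then have "abs ` set \<sigma> = insert (int (Suc d)) (abs ` set \<sigma>) - {int (Suc d)}"
    by (rule Diff_insert_absorb[symmetric])
  also have "\<dots> = {1..int (Suc d)} - {int (Suc d)}" using a by (simp add: flags_def)
  also have "\<dots> = {1..int d}" by auto
  finally show "\<sigma> \<in> flags d" using a by (simp add: flags_def)
next
  assume a: "\<sigma> \<in> flags d"
  have "int (Suc d) \<notin> abs ` set \<sigma>" using a by (simp add: flags_def)
  moreover have "insert (int (Suc d)) {1..int d} = {1..int (Suc d)}" by auto
  ultimately show "\<sigma> @ [int (Suc d)] \<in> flags (Suc d)" using a by (auto simp: flags_def)
qed

section \<open>Moves between adjacent maximal chains\<close>

definition swap_at :: "nat \<Rightarrow> 'a list \<Rightarrow> 'a list" where
  "swap_at i xs = xs[i - 1 := xs ! i, i := xs ! (i - 1)]"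

definition flip_last :: "int list \<Rightarrow> int list" where
  "flip_last xs = butlast xs @ [- last xs]"

lemma swap_at_append:
  "swap_at (Suc (length us)) (us @ a # b # vs) = us @ b # a # vs"
  by (simp add: swap_at_def list_update_append nth_append)

lemma split_at:
  assumes "1 \<le> i" "i < length xs"
  obtains us a b vs where "xs = us @ a # b # vs" "i = Suc (length us)"
proof
  show "xs = take (i - 1) xs @ xs ! (i - 1) # xs ! i # drop (Suc i) xs"
    using assms by (metis Cons_nth_drop_Suc Suc_diff_1 Suc_lessD append_take_drop_id less_eq_Suc_le One_nat_def)
  show "i = Suc (length (take (i - 1) xs))" using assms by simp
qed

text \<open>A shorter prefix contains neither of the exchanged entries, a longer one contains
  both.\<close>

lemma set_take_swap_at:
  assumes "1 \<le> i" "i < length xs" "j \<noteq> i"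
  shows "set (take j (swap_at i xs)) = set (take j xs)"
proof -
  obtain us a b vs where xs: "xs = us @ a # b # vs" "i = Suc (length us)"
    using split_at assms by blast
  have "j \<le> length us \<or> (\<exists>m. j = length us + Suc (Suc m))"
    using assms(3) xs(2) by presburger
  then show ?thesis unfolding xs swap_at_append by auto
qed

text \<open>These are the hypotheses of Ky Fan's lemma: an antipodal labelling without complementary
  edges. The case \<open>x = y\<close> excludes the label 0.\<close>

locale octahedral_labelling =
  fixes n :: nat and lab :: "int set \<Rightarrow> int"
  assumes lab_uminus: "signed_set n x \<Longrightarrow> lab (uminus ` x) = - lab x"
    and lab_compl: "signed_set n x \<Longrightarrow> signed_set n y \<Longrightarrow> x \<subseteq> y \<Longrightarrow> lab x \<noteq> - lab y"
begin

definition labels :: "int list \<Rightarrow> nat set \<Rightarrow> int set" where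
  "labels \<sigma> J = (\<lambda>j. lab (set (take j \<sigma>))) ` J"

lemma lab_noncompl:
  assumes "\<sigma> \<in> flags d" "d \<le> n" "i \<in> {1..d}" "j \<in> {1..d}"
  shows "lab (set (take i \<sigma>)) \<noteq> - lab (set (take j \<sigma>))"
proof -
  have s: "signed_set n (set (take i \<sigma>))" "signed_set n (set (take j \<sigma>))"
    using signed_set_take assms by auto
  have "set (take i \<sigma>) \<subseteq> set (take j \<sigma>) \<or> set (take j \<sigma>) \<subseteq> set (take i \<sigma>)"
    using set_take_subset_set_take[of i j \<sigma>] set_take_subset_set_take[of j i \<sigma>] by linarith
  then show ?thesis using lab_compl[OF s] lab_compl[OF s(2,1)] by (metis minus_minus)
qed

text \<open>Labels along a chain are never opposite to each other or to themselves.\<close>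

lemma labels_abs_inj:
  assumes "\<sigma> \<in> flags d" "d \<le> n" "J \<subseteq> {1..d}"
  shows "inj_on abs (labels \<sigma> J)" and "0 \<notin> labels \<sigma> J"
proof -
  have nc: "v \<noteq> - w" if "v \<in> labels \<sigma> J" "w \<in> labels \<sigma> J" for v w
  proof -
    obtain i j where "i \<in> J" "v = lab (set (take i \<sigma>))" "j \<in> J" "w = lab (set (take j \<sigma>))"
      using \<open>v \<in> _\<close> \<open>w \<in> _\<close> unfolding labels_def by blast
    moreover from this have "i \<in> {1..d}" "j \<in> {1..d}" using assms(3) by blast+
    ultimately show ?thesis using lab_noncompl[OF assms(1,2)] by simp
  qed
  show "inj_on abs (labels \<sigma> J)"
  proof (rule inj_onI)
    fix v w assume "v \<in> labels \<sigma> J" "w \<in> labels \<sigma> J" "\<bar>v\<bar> = \<bar>w\<bar>"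
    then show "v = w" using nc[of v w] abs_eq_iff[of v w] by blast
  qed
  show "0 \<notin> labels \<sigma> J" using nc[of 0 0] by auto
qed

lemma labels_uminus:
  assumes "\<sigma> \<in> flags d" "d \<le> n" "J \<subseteq> {1..d}"
  shows "labels (map uminus \<sigma>) J = uminus ` labels \<sigma> J"
proof -
  have "lab (set (take j (map uminus \<sigma>))) = - lab (set (take j \<sigma>))" if "j \<in> J" for j
  proof -
    have "signed_set n (set (take j \<sigma>))"
      using assms that by (intro signed_set_take[of \<sigma> d]) auto
    then show ?thesis using lab_uminus by (simp add: take_map)
  qed
  then show ?thesis unfolding labels_def image_image by (rule image_cong[OF refl])
qed

section \<open>Parity of the number of alternating maximal chains\<close>

definition full_alt :: "nat \<Rightarrow> bool \<Rightarrow> int list set" where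
  "full_alt d e = {\<sigma> \<in> flags d. card (labels \<sigma> {1..d}) = d \<and> alternating e (labels \<sigma> {1..d})}"

lemma full_alt_uminus:
  assumes "d \<le> n" "\<sigma> \<in> full_alt d e"
  shows "map uminus \<sigma> \<in> full_alt d (\<not> e)"
proof -
  have f: "\<sigma> \<in> flags d" using assms by (simp add: full_alt_def)
  have "card (uminus ` labels \<sigma> {1..d}) = card (labels \<sigma> {1..d})" by (simp add: card_image)
  then show ?thesis
    using assms flags_uminus[OF f] labels_uminus[OF f assms(1) order_refl]
      labels_abs_inj(2)[OF f assms(1) order_refl] alternating_uminus
    by (simp add: full_alt_def)
qed

text \<open>In a maximal chain the facets with positively alternating labels are even in number, unless
  the chain is itself alternating: two equal labels can only be deleted one for the other, and
  otherwise the deletions are counted by \<open>odd_card_alternating_deletions\<close>.\<close>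

lemma odd_card_alternating_facets:
  assumes s: "\<sigma> \<in> flags d" and d: "d \<le> n" "1 \<le> d"
  shows "odd (card {i \<in> {1..d}. card (labels \<sigma> ({1..d} - {i})) = d - 1 \<and>
                                 alternating True (labels \<sigma> ({1..d} - {i}))})
     \<longleftrightarrow> \<sigma> \<in> full_alt d True \<or> \<sigma> \<in> full_alt d False"
    (is "odd (card ?D) \<longleftrightarrow> _")
proof -
  define l where "l = (\<lambda>j. lab (set (take j \<sigma>)))"
  have labels_l: "labels \<sigma> J = l ` J" for J by (simp add: labels_def l_def)
  let ?L = "labels \<sigma> {1..d}"
  have fin: "finite ?L" by (simp add: labels_l)
  have abs: "inj_on abs ?L" using labels_abs_inj[OF s d(1)] by simp
  show ?thesis
  proof (cases "inj_on l {1..d}")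
    case True
    have card: "card ?L = d" unfolding labels_l using True by (simp add: card_image)
    have del: "labels \<sigma> ({1..d} - {i}) = ?L - {l i}" if "i \<in> {1..d}" for i
      unfolding labels_l using inj_on_image_set_diff[OF True, of "{1..d}" "{i}"] that by simp
    have "card (?L - {l i}) = d - 1" if "i \<in> {1..d}" for i
    proof -
      have "l i \<in> ?L" unfolding labels_l using that by (rule imageI)
      then show ?thesis using card by (simp add: card_Diff_singleton)
    qed
    then have "?D = {i \<in> {1..d}. alternating True (?L - {l i})}"
      using del by (intro Collect_cong) metis
    then have "l ` ?D = l ` {i \<in> {1..d}. alternating True (?L - {l i})}" by (rule arg_cong)
    also have "l ` {i \<in> {1..d}. alternating True (?L - {l i})}
        = {v \<in> ?L. alternating True (?L - {v})}"
      unfolding labels_l by blast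
    finally have "l ` ?D = {v \<in> ?L. alternating True (?L - {v})}" .
    moreover have "card (l ` ?D) = card ?D"
      by (rule card_image, rule inj_on_subset[OF True]) blast
    moreover have "?L \<noteq> {}" using d by (simp add: labels_l)
    ultimately have "odd (card ?D) \<longleftrightarrow> alternating True ?L \<or> alternating (\<not> True) ?L"
      using odd_card_alternating_deletions[OF fin abs, of True] by presburger
    then show ?thesis using card s by (simp add: full_alt_def)
  next
    case False
    then obtain a b where ab: "a \<in> {1..d}" "b \<in> {1..d}" "a \<noteq> b" "l a = l b"
      unfolding inj_on_def by blast
    have img: "l ` (J - {a}) = l ` J" "l ` (J - {b}) = l ` J" if "a \<in> J" "b \<in> J" for J
    proof -
      have "b \<in> J - {a}" "a \<in> J - {b}" using that ab(3) by blast+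
      then have "l a \<in> l ` (J - {a})" "l b \<in> l ` (J - {b})"
        using ab(4) by (metis imageI)+
      moreover have "l ` J = insert (l a) (l ` (J - {a}))" "l ` J = insert (l b) (l ` (J - {b}))"
        using that by (metis image_insert insert_Diff)+
      ultimately show "l ` (J - {a}) = l ` J" "l ` (J - {b}) = l ` J"
        by (metis insert_absorb)+
    qed
    \<comment> \<open>If the omitted step is neither \<open>a\<close> nor \<open>b\<close>, the
      repeated label remains, and too few distinct labels are left.\<close>
    have small: "card (l ` ({1..d} - {i})) < d - 1" if "i \<in> {1..d}" "i \<noteq> a" "i \<noteq> b" for i
    proof -
      have "l ` ({1..d} - {i} - {a}) = l ` ({1..d} - {i})"
        using that ab(1,2) by (intro img(1)) auto
      then have "card (l ` ({1..d} - {i})) = card (l ` ({1..d} - {i} - {a}))"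
        by (rule arg_cong[OF sym])
      also have "\<dots> \<le> card ({1..d} - {i} - {a})"
        by (intro card_image_le finite_Diff finite_atLeastAtMost)
      also have "\<dots> < card ({1..d} - {i})"
        using ab(1) that by (intro card_Diff1_less) auto
      finally show ?thesis using that by simp
    qed
    have "?D \<subseteq> {a, b}"
    proof
      fix i assume "i \<in> ?D"
      then have "i \<in> {1..d}" "card (l ` ({1..d} - {i})) = d - 1" by (simp_all add: labels_l)
      then show "i \<in> {a, b}" using small[of i] by (metis insertCI less_irrefl)
    qed
    moreover have "a \<in> ?D \<longleftrightarrow> b \<in> ?D"
    proof -
      have "l ` ({1..d} - {a}) = l ` ({1..d} - {b})" using img[OF ab(1,2)] by simp
      then show ?thesis using ab unfolding labels_l by simp
    qed
    ultimately have "?D = {} \<or> ?D = {a, b}" by blast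
    moreover have "even (card D)" if "D = {} \<or> D = {a, b}" for D using that ab(3) by auto
    ultimately have "even (card ?D)" by blast
    moreover have "card ?L \<noteq> d" unfolding labels_l
      using False eq_card_imp_inj_on[of "{1..d}" l] by fastforce
    ultimately show ?thesis by (simp add: full_alt_def)
  qed
qed

text \<open>The antipodal map sends the positively starting chains outside the hemisphere to the
  negatively starting ones inside.\<close>

lemma card_full_alt_hemisphere:
  assumes d: "d \<le> n" "1 \<le> d"
  shows "card (full_alt d True)
       = card {\<sigma> \<in> flags d. int d \<in> set \<sigma> \<and> (\<sigma> \<in> full_alt d True \<or> \<sigma> \<in> full_alt d False)}"
proof -
  let ?T = "\<lambda>e. full_alt d e"
  let ?H = "{\<sigma>. int d \<in> set \<sigma>}"
  have fin: "finite (?T e)" for e using finite_flags by (simp add: full_alt_def)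
  have fl: "?T e \<subseteq> flags d" for e by (auto simp: full_alt_def)
  have disj: "?T True \<inter> ?T False = {}"
  proof -
    have "labels \<sigma> {1..d} \<noteq> {}" for \<sigma>
      using d by (auto simp: labels_def)
    then show ?thesis using alternating_not_both[where e = True] by (force simp: full_alt_def)
  qed
  have "bij_betw (map uminus) (?T True - ?H) (?T False \<inter> ?H)"
  proof (rule bij_betw_byWitness[where f' = "map uminus"])
    show "map uminus ` (?T True - ?H) \<subseteq> ?T False \<inter> ?H"
    proof
      fix \<tau> assume "\<tau> \<in> map uminus ` (?T True - ?H)"
      then obtain \<sigma> where t: "\<tau> = map uminus \<sigma>" "\<sigma> \<in> ?T True" "int d \<notin> set \<sigma>" by auto
      then have "- int d \<in> set \<sigma>" using flags_iff_mem d fl by blast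
      then have "int d \<in> set \<tau>" using t(1) by force
      then show "\<tau> \<in> ?T False \<inter> ?H" using full_alt_uminus[OF d(1) t(2)] t(1) by simp
    qed
    show "map uminus ` (?T False \<inter> ?H) \<subseteq> ?T True - ?H"
    proof
      fix \<tau> assume "\<tau> \<in> map uminus ` (?T False \<inter> ?H)"
      then obtain \<sigma> where t: "\<tau> = map uminus \<sigma>" "\<sigma> \<in> ?T False" "int d \<in> set \<sigma>" by auto
      then have "- int d \<notin> set \<sigma>" using flags_iff_mem d fl by blast
      then have "int d \<notin> set \<tau>" using t(1) by (auto simp: minus_equation_iff)
      then show "\<tau> \<in> ?T True - ?H" using full_alt_uminus[OF d(1) t(2)] t(1) by simp
    qed
  qed (auto simp: comp_def)
  then have "card (?T True - ?H) = card (?T False \<inter> ?H)" by (rule bij_betw_same_card)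
  moreover have "card (?T True) = card (?T True \<inter> ?H) + card (?T True - ?H)"
    using fin card_Int_Diff by blast
  moreover have "card ((?T True \<inter> ?H) \<union> (?T False \<inter> ?H)) = card (?T True \<inter> ?H) + card (?T False \<inter> ?H)"
    using fin disj by (intro card_Un_disjoint) auto
  moreover have "(?T True \<inter> ?H) \<union> (?T False \<inter> ?H) =
      {\<sigma> \<in> flags d. int d \<in> set \<sigma> \<and> (\<sigma> \<in> ?T True \<or> \<sigma> \<in> ?T False)}"
    using fl by auto
  ultimately show ?thesis by simp
qed

lemma labels_cong:
  "(\<And>j. j \<in> J \<Longrightarrow> set (take j \<sigma>) = set (take j \<tau>)) \<Longrightarrow> labels \<sigma> J = labels \<tau> J"
  by (simp add: labels_def)

text \<open>Incidences between maximal chains of the closed hemisphere, where coordinate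
  \<open>d\<close> is not negative, and their positively alternating faces. Their number is
  evaluated modulo 2 in two ways, by chains and by faces.\<close>

definition alt_facets :: "nat \<Rightarrow> (int list \<times> nat) set" where
  "alt_facets d = (SIGMA \<sigma>:{\<sigma> \<in> flags d. int d \<in> set \<sigma>}.
     {i \<in> {1..d}. card (labels \<sigma> ({1..d} - {i})) = d - 1 \<and> alternating True (labels \<sigma> ({1..d} - {i}))})"

text \<open>A codimension-one face lies in exactly two facets of the closed hemisphere (swap the two
  steps around the missing set, or flip the last sign), except for the faces on the equator.\<close>

lemma even_card_interior_alt_facets:
  assumes "1 \<le> d"
  shows "even (card {p \<in> alt_facets d. \<not> (snd p = d \<and> last (fst p) = int d)})"
    (is "even (card ?E)")
proof (rule even_card_involution)
  have "finite (alt_facets d)" unfolding alt_facets_def using finite_flags by (intro finite_SigmaI) auto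
  then show "finite ?E" by simp
  let ?f = "\<lambda>(\<sigma>, i). if i < d then (swap_at i \<sigma>, i) else (flip_last \<sigma>, i)"
  fix p assume "p \<in> ?E"
  then obtain \<sigma> i where p: "p = (\<sigma>, i)" "(\<sigma>, i) \<in> alt_facets d" "\<not> (i = d \<and> last \<sigma> = int d)"
    by (cases p) auto
  then have s: "\<sigma> \<in> flags d" "int d \<in> set \<sigma>" and i: "1 \<le> i" "i \<le> d"
    by (auto simp: alt_facets_def)
  have len: "length \<sigma> = d" using length_flags s by blast
  have memI: "(\<tau>, i) \<in> alt_facets d"
    if "\<tau> \<in> flags d" "int d \<in> set \<tau>" "\<And>j. j \<in> {1..d} - {i} \<Longrightarrow> set (take j \<tau>) = set (take j \<sigma>)" for \<tau>
    using p(2) that labels_cong[of "{1..d} - {i}" \<tau> \<sigma>] by (simp add: alt_facets_def)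
  show "?f p \<in> ?E \<and> ?f p \<noteq> p \<and> ?f (?f p) = p"
  proof (cases "i < d")
    case True
    obtain us a b vs where ab: "\<sigma> = us @ a # b # vs" "i = Suc (length us)"
      using split_at i len True by blast
    have sw: "swap_at i \<sigma> = us @ b # a # vs" "swap_at i (us @ b # a # vs) = \<sigma>"
      using ab swap_at_append by auto
    have "us @ a # b # vs \<in> flags d" using s(1) ab(1) by simp
    then have "us @ b # a # vs \<in> flags d" by (auto simp: flags_def insert_commute)
    then have "swap_at i \<sigma> \<in> flags d" using sw(1) by simp
    moreover have "int d \<in> set (swap_at i \<sigma>)"
    proof -
      have "int d \<in> set (us @ a # b # vs)" using s(2) ab(1) by simp
      then show ?thesis unfolding sw(1) by auto
    qed
    ultimately have "(swap_at i \<sigma>, i) \<in> alt_facets d"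
      using set_take_swap_at[of i \<sigma>] i len True by (intro memI) auto
    moreover have "a \<noteq> b" using s(1) ab by (auto simp: flags_def)
    ultimately show ?thesis using p True sw ab(1) by auto
  next
    case False
    then have id: "i = d" using i by simp
    then have l: "last \<sigma> \<noteq> int d" using p by simp
    have ne: "\<sigma> \<noteq> []" using len assms by auto
    then obtain us a where ab: "\<sigma> = us @ [a]" by (metis rev_exhaust)
    have fl: "flip_last \<sigma> = us @ [- a]" "flip_last (us @ [- a]) = \<sigma>" by (auto simp: flip_last_def ab)
    \<comment> \<open>The last entry is not \<open>int d\<close> by the excluded case and not
      \<open>- int d\<close> inside the hemisphere, so flipping it keeps \<open>int d\<close> and
      does not lead to an equatorial face.\<close>
    have a: "a \<noteq> int d" "a \<noteq> 0" "a \<noteq> - int d"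
      using l ab flags_nonzero[OF s(1)] flags_uminus_notin[OF s] by auto
    have "us @ [a] \<in> flags d" using s(1) ab by simp
    then have "flip_last \<sigma> \<in> flags d" unfolding fl(1) by (simp add: flags_def)
    moreover have "int d \<in> set (flip_last \<sigma>)" using s(2) a fl ab by auto
    ultimately have "(flip_last \<sigma>, i) \<in> alt_facets d"
      using id len ab fl by (intro memI) auto
    then show ?thesis using p id fl ab a by auto
  qed
qed

text \<open>Omitting the final step of a chain that ends with \<open>int (Suc d)\<close> leaves a
  maximal chain on the first \<open>d\<close> coordinates.\<close>

lemma card_equator_alt_facets:
  assumes "Suc d \<le> n"
  shows "card {p \<in> alt_facets (Suc d). snd p = Suc d \<and> last (fst p) = int (Suc d)}
       = card (full_alt d True)" (is "card ?E = _")
proof -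
  have mem: "(\<sigma> @ [int (Suc d)], Suc d) \<in> alt_facets (Suc d) \<longleftrightarrow> \<sigma> \<in> full_alt d True" for \<sigma>
  proof (cases "\<sigma> \<in> flags d")
    case True
    have "labels (\<sigma> @ [int (Suc d)]) {1..d} = labels \<sigma> {1..d}"
      using length_flags[OF True] by (intro labels_cong) auto
    moreover have "{1..Suc d} - {Suc d} = {1..d}" by auto
    ultimately show ?thesis using True flags_snoc by (simp add: alt_facets_def full_alt_def)
  next
    case False
    then show ?thesis using flags_snoc by (simp add: alt_facets_def full_alt_def)
  qed
  have "?E = (\<lambda>\<sigma>. (\<sigma> @ [int (Suc d)], Suc d)) ` full_alt d True"
  proof (rule set_eqI, rule iffI)
    fix p assume p: "p \<in> ?E"
    then obtain \<sigma> where s: "p = (\<sigma>, Suc d)" "last \<sigma> = int (Suc d)" "\<sigma> \<in> flags (Suc d)"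
      by (cases p) (auto simp: alt_facets_def)
    then have "\<sigma> \<noteq> []" using length_flags by fastforce
    then have "\<sigma> = butlast \<sigma> @ [int (Suc d)]" using s(2) by (metis append_butlast_last_id)
    then show "p \<in> (\<lambda>\<sigma>. (\<sigma> @ [int (Suc d)], Suc d)) ` full_alt d True"
      using p s mem[of "butlast \<sigma>"] by (intro image_eqI[of _ _ "butlast \<sigma>"]) auto
  qed (use mem in auto)
  then show ?thesis by (simp add: card_image inj_on_def)
qed

text \<open>Counted by chains, the incidences in dimension \<open>Suc d\<close> have the parity of
  \<open>full_alt (Suc d) True\<close>. Counted by faces, the interior ones cancel in pairs and the
  equatorial ones form \<open>full_alt d True\<close>. The induction starts with the single empty
  chain.\<close>

theorem odd_card_full_alt: "d \<le> n \<Longrightarrow> odd (card (full_alt d True))"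
proof (induction d)
  case 0
  have "full_alt 0 True = {[]}" by (auto simp: full_alt_def flags_def labels_def)
  then show ?case by simp
next
  case (Suc d)
  let ?H = "{\<sigma> \<in> flags (Suc d). int (Suc d) \<in> set \<sigma>}"
  let ?D = "\<lambda>\<sigma>. {i \<in> {1..Suc d}. card (labels \<sigma> ({1..Suc d} - {i})) = Suc d - 1 \<and>
                   alternating True (labels \<sigma> ({1..Suc d} - {i}))}"
  have finH: "finite ?H" using finite_flags by simp
  have finE: "finite (alt_facets (Suc d))"
    unfolding alt_facets_def using finite_flags by (intro finite_SigmaI) auto
  have "card (alt_facets (Suc d)) = (\<Sum>\<sigma>\<in>?H. card (?D \<sigma>))"
    unfolding alt_facets_def using finH by (intro card_SigmaI) auto
  then have "odd (card (alt_facets (Suc d))) \<longleftrightarrow> odd (card {\<sigma> \<in> ?H. odd (card (?D \<sigma>))})"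
    using even_sum_iff[OF finH, of "\<lambda>\<sigma>. card (?D \<sigma>)"] by simp
  also have "{\<sigma> \<in> ?H. odd (card (?D \<sigma>))} = {\<sigma> \<in> flags (Suc d). int (Suc d) \<in> set \<sigma> \<and>
      (\<sigma> \<in> full_alt (Suc d) True \<or> \<sigma> \<in> full_alt (Suc d) False)}"
    using odd_card_alternating_facets[OF _ Suc.prems] by auto
  finally have 1: "odd (card (alt_facets (Suc d))) \<longleftrightarrow> odd (card (full_alt (Suc d) True))"
    using card_full_alt_hemisphere[OF Suc.prems] by simp
  let ?Q = "\<lambda>p. snd p = Suc d \<and> last (fst p) = int (Suc d)"
  have "alt_facets (Suc d) = {p \<in> alt_facets (Suc d). ?Q p} \<union> {p \<in> alt_facets (Suc d). \<not> ?Q p}"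
    by auto
  then have "card (alt_facets (Suc d))
      = card {p \<in> alt_facets (Suc d). ?Q p} + card {p \<in> alt_facets (Suc d). \<not> ?Q p}"
    using finE by (metis (no_types, lifting) card_Un_disjoint disjoint_iff finite_Un mem_Collect_eq)
  then show ?case
    using 1 card_equator_alt_facets[OF Suc.prems] even_card_interior_alt_facets[of "Suc d"] Suc
    by simp
qed

end

section \<open>Labels for sign vectors without large stable sets\<close>

lemma almost_stable_subset: "almost_stable s S \<Longrightarrow> T \<subseteq> S \<Longrightarrow> almost_stable s T"
  unfolding almost_stable_def by blast

section \<open>Largest stable subsets and their first elements\<close>

definition stable_number :: "nat \<Rightarrow> nat set \<Rightarrow> nat" where
  "stable_number s X = Max (card ` {S. S \<subseteq> X \<and> almost_stable s S})"

lemma stable_number_ge: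
  assumes "finite X" "S \<subseteq> X" "almost_stable s S"
  shows "card S \<le> stable_number s X"
  unfolding stable_number_def using assms by (intro Max_ge) auto

lemma stable_number_attained:
  assumes "finite X"
  obtains S where "S \<subseteq> X" "almost_stable s S" "card S = stable_number s X"
proof -
  let ?F = "{S. S \<subseteq> X \<and> almost_stable s S}"
  have "finite ?F" using assms by simp
  moreover have "{} \<in> ?F" by (simp add: almost_stable_def)
  ultimately have "Max (card ` ?F) \<in> card ` ?F" by (intro Max_in finite_imageI) blast+
  then obtain S where "Max (card ` ?F) = card S" "S \<in> ?F" by (rule imageE)
  then show thesis using that[of S] by (simp add: stable_number_def)
qed

lemma stable_number_mono:
  assumes "finite Y" "X \<subseteq> Y"
  shows "stable_number s X \<le> stable_number s Y"
  using stable_number_attained[OF finite_subset[OF assms(2,1)], of s] stable_number_ge[OF assms(1)] assms(2)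
  by (metis order_trans)

lemma stable_number_pos:
  assumes "finite X" "X \<noteq> {}"
  shows "stable_number s X \<ge> 1"
proof -
  obtain x where "x \<in> X" using assms by blast
  then have "card {x} \<le> stable_number s X"
    using assms by (intro stable_number_ge) (auto simp: almost_stable_def)
  then show ?thesis by simp
qed

definition starts :: "nat \<Rightarrow> nat set \<Rightarrow> nat set" where
  "starts s X = {p. \<exists>S\<subseteq>X. almost_stable s S \<and> card S = stable_number s X \<and> p \<in> S \<and> (\<forall>q\<in>S. p \<le> q)}"

lemma starts_subset: "starts s X \<subseteq> X"
  by (auto simp: starts_def)

lemma starts_nonempty:
  assumes "finite X" "X \<noteq> {}"
  shows "starts s X \<noteq> {}"
proof -
  obtain S where S: "S \<subseteq> X" "almost_stable s S" "card S = stable_number s X"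
    using stable_number_attained[OF assms(1)] by blast
  then have "S \<noteq> {}" using stable_number_pos[OF assms, of s] by auto
  moreover have "finite S" using S(1) assms(1) finite_subset by blast
  ultimately have "Min S \<in> S" "\<forall>q\<in>S. Min S \<le> q" by auto
  then show ?thesis using S by (auto simp: starts_def)
qed

text \<open>A maximum stable set of \<open>X\<close> stays maximum in \<open>Y\<close> as long as
  the stable number does not grow.\<close>

lemma starts_mono:
  assumes "X \<subseteq> Y" "stable_number s X = stable_number s Y"
  shows "starts s X \<subseteq> starts s Y"
proof
  fix p assume "p \<in> starts s X"
  then obtain S where "S \<subseteq> X" "almost_stable s S" "card S = stable_number s X" "p \<in> S" "\<forall>q\<in>S. p \<le> q"
    unfolding starts_def by blast
  then show "p \<in> starts s Y"
    unfolding starts_def using assms by (intro CollectI exI[of _ S]) auto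
qed

text \<open>If \<open>p\<close> were at distance at least \<open>s\<close> before \<open>q\<close>, it could be added to a maximum
  stable set starting at \<open>q\<close>.\<close>

lemma starts_close:
  assumes "finite X" "s \<ge> 1" "p \<in> starts s X" "q \<in> starts s X"
  shows "q < p + s"
proof (rule ccontr)
  assume far: "\<not> q < p + s"
  obtain S where S: "S \<subseteq> X" "almost_stable s S" "card S = stable_number s X" "\<forall>r\<in>S. q \<le> r"
    using assms(4) unfolding starts_def by blast
  have "almost_stable s (insert p S)"
    using S(2,4) far unfolding almost_stable_def by fastforce
  then have "card (insert p S) \<le> stable_number s X"
    using S(1) assms starts_subset[of s X] by (intro stable_number_ge) auto
  moreover have "p \<notin> S" using S(4) far assms(2) by fastforce
  moreover have "finite S" using S(1) assms(1) finite_subset by blast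
  ultimately show False using S(3) by simp
qed

section \<open>Zigzags between two sets of small spread\<close>

definition zigzag :: "nat set \<Rightarrow> nat set \<Rightarrow> nat \<Rightarrow> bool" where
  "zigzag A B j \<longleftrightarrow> (\<exists>f::nat \<Rightarrow> nat. (\<forall>i<j. f i \<in> (if even i then A else B)) \<and>
                                   (\<forall>i. Suc i < j \<longrightarrow> f i < f (Suc i)))"

lemma zigzag_mono: "zigzag A B j \<Longrightarrow> A \<subseteq> A' \<Longrightarrow> B \<subseteq> B' \<Longrightarrow> zigzag A' B' j"
  unfolding zigzag_def by (metis subsetD)

lemma zigzag_Suc:
  assumes "\<forall>i<j. f i \<in> (if even i then B else A)" "\<forall>i. Suc i < j \<longrightarrow> f i < f (Suc i)"
    "a \<in> A" "a < f 0"
  shows "zigzag A B (Suc j)"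
proof -
  have "case_nat a f i \<in> (if even i then A else B)" if "i < Suc j" for i
    using assms that by (cases i) auto
  moreover have "case_nat a f i < case_nat a f (Suc i)" if "Suc i < Suc j" for i
    using assms that by (cases i) auto
  ultimately show ?thesis unfolding zigzag_def by blast
qed

text \<open>Of the two zigzags, the one that starts later can be preceded by the first element of
  the other. Two different first signs are therefore impossible at the greatest length.\<close>

lemma zigzag_extend:
  assumes "A \<inter> B = {}" "j \<ge> 1" "zigzag A B j" "zigzag B A j"
  shows "zigzag A B (Suc j) \<or> zigzag B A (Suc j)"
proof -
  obtain f where f: "\<forall>i<j. f i \<in> (if even i then A else B)" "\<forall>i. Suc i < j \<longrightarrow> f i < f (Suc i)"
    using assms(3) unfolding zigzag_def by blast
  obtain g where g: "\<forall>i<j. g i \<in> (if even i then B else A)" "\<forall>i. Suc i < j \<longrightarrow> g i < g (Suc i)"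
    using assms(4) unfolding zigzag_def by blast
  have "f 0 \<in> A" "g 0 \<in> B" using f(1)[rule_format, of 0] g(1)[rule_format, of 0] assms(2) by auto
  then have "f 0 < g 0 \<or> g 0 < f 0" using assms(1) by (metis disjoint_iff nat_neq_iff)
  then show ?thesis
    using zigzag_Suc[OF g \<open>f 0 \<in> A\<close>] zigzag_Suc[OF f \<open>g 0 \<in> B\<close>] by blast
qed

lemma zigzag_two:
  assumes "A \<inter> B = {}" "A \<noteq> {}" "B \<noteq> {}"
  shows "zigzag A B 2 \<or> zigzag B A 2"
proof -
  have "zigzag A B 1" "zigzag B A 1" using assms by (auto simp: zigzag_def)
  then show ?thesis using zigzag_extend[OF assms(1), of 1] by (simp add: numeral_2_eq_2)
qed

lemma increasing_gap:
  fixes f :: "nat \<Rightarrow> nat"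
  assumes "\<forall>i. Suc i < j \<longrightarrow> f i < f (Suc i)" "i + m < j"
  shows "f i + m \<le> f (i + m)"
  using assms(2)
proof (induction m)
  case (Suc m)
  then have "f i + m \<le> f (i + m)" "f (i + m) < f (Suc (i + m))" using assms(1) by auto
  then show ?case by simp
qed simp

text \<open>This isolates what is used about the starting points of two disjoint sets with equal
  stable numbers.\<close>

definition close_pair :: "nat \<Rightarrow> nat set \<Rightarrow> nat set \<Rightarrow> bool" where
  "close_pair s A B \<longleftrightarrow> A \<noteq> {} \<and> B \<noteq> {} \<and> A \<inter> B = {} \<and>
     (\<forall>p\<in>A. \<forall>q\<in>A. q < p + s) \<and> (\<forall>p\<in>B. \<forall>q\<in>B. q < p + s)"

lemma close_pair_sym: "close_pair s A B \<Longrightarrow> close_pair s B A"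
  by (auto simp: close_pair_def)

text \<open>For even \<open>s\<close> the first and last of the \<open>s + 1\<close> entries both
  lie in \<open>A\<close>, yet they are at least \<open>s\<close> apart.\<close>

lemma not_zigzag_Suc_even:
  assumes "close_pair s A B" "even s"
  shows "\<not> zigzag A B (Suc s)"
proof
  assume "zigzag A B (Suc s)"
  then obtain f where f: "\<forall>i<Suc s. f i \<in> (if even i then A else B)"
      "\<forall>i. Suc i < Suc s \<longrightarrow> f i < f (Suc i)"
    unfolding zigzag_def by blast
  have "f 0 \<in> A" "f s \<in> A" using f(1)[rule_format, of 0] f(1)[rule_format, of s] assms(2) by auto
  then have "f s < f 0 + s" using assms(1) by (auto simp: close_pair_def)
  then show False using increasing_gap[OF f(2), of 0 s] by simp
qed

text \<open>A zigzag of odd length \<open>s\<close> must occupy \<open>s\<close> consecutive integers.\<close>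

lemma zigzag_odd_parity:
  assumes "close_pair s A B" "odd s" "s \<ge> 2" "zigzag A B s"
  shows "(\<forall>p\<in>A. even p) \<and> (\<forall>p\<in>B. odd p) \<or> (\<forall>p\<in>A. odd p) \<and> (\<forall>p\<in>B. even p)"
proof -
  obtain f where f: "\<forall>i<s. f i \<in> (if even i then A else B)" "\<forall>i. Suc i < s \<longrightarrow> f i < f (Suc i)"
    using assms(4) unfolding zigzag_def by blast
  have s3: "s \<ge> 3" using assms(2,3) by presburger
  have A: "\<And>p q. p \<in> A \<Longrightarrow> q \<in> A \<Longrightarrow> q < p + s" and B: "\<And>p q. p \<in> B \<Longrightarrow> q \<in> B \<Longrightarrow> q < p + s"
    and disj: "A \<inter> B = {}"
    using assms(1) by (auto simp: close_pair_def)
  have ends: "f 0 \<in> A" "f (s - 1) \<in> A"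
    using f(1)[rule_format, of 0] f(1)[rule_format, of "s - 1"] assms(2) s3 by auto
  have fi: "f i = f 0 + i" if "i < s" for i
  proof -
    have "f 0 + i \<le> f i" using increasing_gap[OF f(2), of 0 i] that by simp
    moreover have "f i + (s - 1 - i) \<le> f (s - 1)"
      using increasing_gap[OF f(2), of i "s - 1 - i"] that by simp
    moreover have "f (s - 1) < f 0 + s" using A ends by blast
    ultimately show ?thesis using that by linarith
  qed
  have inner: "f 0 + i \<in> A \<longleftrightarrow> even i" "f 0 + i \<in> B \<longleftrightarrow> odd i" if "i < s" for i
    using f(1)[rule_format, OF that] fi[OF that] disj by (auto split: if_splits)
  have a: "even (p - f 0) \<and> f 0 \<le> p" if "p \<in> A" for p
  proof -
    have "p < f 0 + s" "f 0 + (s - 1) < p + s"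
      using A[OF ends(1) that] A[OF that ends(2)] fi[of "s - 1"] s3 by linarith+
    then have "f 0 \<le> p" "p - f 0 < s" by linarith+
    then show ?thesis using inner(1)[of "p - f 0"] that by simp
  qed
  have b: "odd (p + f 0)" if "p \<in> B" for p
  proof -
    \<comment> \<open>Elements of \<open>A\<close> are confined to the range of the zigzag, while
      those of \<open>B\<close> may lie one step outside it at either end; since \<open>s\<close> is
      odd, both outer positions have the right parity.\<close>
    have "f 0 + 1 \<in> B" "f 0 + (s - 2) \<in> B" using inner(2)[of 1] inner(2)[of "s - 2"] s3 assms(2) by auto
    then have "p < f 0 + 1 + s" "f 0 + (s - 2) < p + s" using B that by blast+
    then consider "p + 1 = f 0" | "p = f 0 + s" | "f 0 \<le> p" "p - f 0 < s" using s3 by linarith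
    then show ?thesis
    proof cases
      case 3
      then have "odd (p - f 0)" using inner(2)[of "p - f 0"] that by simp
      then show ?thesis using 3 by simp
    next
      case 1
      then show ?thesis by (metis add.commute even_plus_one_iff odd_add)
    next
      case 2
      then show ?thesis using assms(2) by simp
    qed
  qed
  have "even (p + f 0)" if "p \<in> A" for p using a[OF that] by auto
  then have "even p \<longleftrightarrow> even (f 0)" if "p \<in> A" for p using that by simp
  moreover have "odd p \<longleftrightarrow> even (f 0)" if "p \<in> B" for p using b[OF that] by simp
  ultimately show ?thesis by (cases "even (f 0)") blast+
qed

text \<open>The cap keeps the height within a block of \<open>s\<close> indices, since zigzags of
  length \<open>s + 1\<close> can occur for odd \<open>s\<close>.\<close>

definition height :: "nat \<Rightarrow> nat set \<Rightarrow> nat set \<Rightarrow> nat" where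
  "height s A B = Max {j. j \<le> s \<and> (zigzag A B j \<or> zigzag B A j)}"

text \<open>For odd \<open>s\<close> a close pair may contain zigzags of length \<open>s + 1\<close>, hence two zigzags of length
  \<open>s\<close> with different first signs; parity then takes over the role of the first sign.\<close>

definition tie_sign :: "nat \<Rightarrow> nat set \<Rightarrow> nat set \<Rightarrow> bool" where
  "tie_sign s A B \<longleftrightarrow>
     (if odd s \<and> height s A B = s then \<forall>p\<in>A. even p else zigzag A B (height s A B))"

lemma height_sym: "height s A B = height s B A"
  unfolding height_def by (metis disj_commute)

lemma height_ge: "j \<le> s \<Longrightarrow> zigzag A B j \<or> zigzag B A j \<Longrightarrow> j \<le> height s A B"
  unfolding height_def by (intro Max_ge) auto

lemma height_attained: "height s A B \<le> s \<and> (zigzag A B (height s A B) \<or> zigzag B A (height s A B))"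
proof -
  let ?J = "{j. j \<le> s \<and> (zigzag A B j \<or> zigzag B A j)}"
  have "0 \<in> ?J" by (simp add: zigzag_def)
  moreover have "finite ?J" by simp
  ultimately have "Max ?J \<in> ?J" by (intro Max_in) auto
  then show ?thesis unfolding height_def by blast
qed

lemma height_ge_2: "close_pair s A B \<Longrightarrow> s \<ge> 2 \<Longrightarrow> height s A B \<ge> 2"
  using zigzag_two[of A B] by (intro height_ge) (auto simp: close_pair_def)

text \<open>Zigzags with both first signs would give a longer one by \<open>zigzag_extend\<close>.
  Below the cap this contradicts maximality, at the cap with even \<open>s\<close> it contradicts
  the spread.\<close>

lemma zigzag_height_exclusive:
  assumes "close_pair s A B" "s \<ge> 2" "\<not> (odd s \<and> height s A B = s)"
  shows "zigzag B A (height s A B) \<longleftrightarrow> \<not> zigzag A B (height s A B)"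
proof
  let ?h = "height s A B"
  assume ba: "zigzag B A ?h"
  show "\<not> zigzag A B ?h"
  proof
    assume "zigzag A B ?h"
    then have z: "zigzag A B (Suc ?h) \<or> zigzag B A (Suc ?h)"
      using ba assms height_ge_2[OF assms(1,2)] by (intro zigzag_extend) (auto simp: close_pair_def)
    show False
    proof (cases "?h = s")
      case True
      then show False
        using z not_zigzag_Suc_even[OF assms(1)] not_zigzag_Suc_even[OF close_pair_sym[OF assms(1)]] assms(3)
        by auto
    next
      case False
      then have "Suc ?h \<le> ?h" using height_attained[of s A B] by (intro height_ge z) simp
      then show False by simp
    qed
  qed
qed (use height_attained in blast)

lemma parity_dichotomy:
  assumes "close_pair s A B" "s \<ge> 2" "odd s" "height s A B = s"
  shows "(\<forall>p\<in>A. even p) \<and> (\<forall>p\<in>B. odd p) \<or> (\<forall>p\<in>A. odd p) \<and> (\<forall>p\<in>B. even p)"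
  using height_attained[of s A B] assms zigzag_odd_parity[of s A B] zigzag_odd_parity[of s B A]
    close_pair_sym[of s A B] by auto

lemma tie_sign_swap:
  assumes "close_pair s A B" "s \<ge> 2"
  shows "tie_sign s B A \<longleftrightarrow> \<not> tie_sign s A B"
proof (cases "odd s \<and> height s A B = s")
  case True
  have ne: "A \<noteq> {}" "B \<noteq> {}" using assms by (auto simp: close_pair_def)
  show ?thesis
    using parity_dichotomy[OF assms] True ne unfolding tie_sign_def height_sym[of s B A] by auto
next
  case False
  then show ?thesis
    using zigzag_height_exclusive[OF assms False] unfolding tie_sign_def height_sym[of s B A] by auto
qed

text \<open>In the parity case a single even element of \<open>A\<close> settles the alternative for
  the larger pair; otherwise the longest zigzag itself survives.\<close>

lemma tie_sign_mono:
  assumes "close_pair s A B" "close_pair s A' B'" "s \<ge> 2" "A \<subseteq> A'" "B \<subseteq> B'"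
    and eq: "height s A B = height s A' B'" and "tie_sign s A B"
  shows "tie_sign s A' B'"
proof (cases "odd s \<and> height s A B = s")
  case True
  obtain p where "p \<in> A" using assms(1) by (auto simp: close_pair_def)
  moreover from this have "even p" using assms(7) True by (simp add: tie_sign_def)
  ultimately show ?thesis
    using parity_dichotomy[OF assms(2,3)] True eq assms(4) unfolding tie_sign_def by auto
next
  case False
  then have "zigzag A B (height s A B)" using assms(7) by (simp add: tie_sign_def)
  then show ?thesis using zigzag_mono assms(4,5) False eq unfolding tie_sign_def by auto
qed

text \<open>When neither part of a sign vector contains an almost \<open>s\<close>-stable \<open>k\<close>-set, the indices are at most
  \<open>s * (k - 1)\<close>: each value \<open>m < k\<close> of the larger stable number owns a block of \<open>s\<close> of them, the
  first for unequal stable numbers and the others for the zigzag height of the two sets of starting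
  points, which only grow with the sign vector as long as the stable numbers do not change.\<close>

definition small_index :: "nat \<Rightarrow> nat set \<Rightarrow> nat set \<Rightarrow> nat" where
  "small_index s P N =
     (if stable_number s P = stable_number s N
      then s * (stable_number s P - 1) + height s (starts s P) (starts s N)
      else s * (max (stable_number s P) (stable_number s N) - 1) + 1)"

definition small_sign :: "nat \<Rightarrow> nat set \<Rightarrow> nat set \<Rightarrow> bool" where
  "small_sign s P N \<longleftrightarrow>
     (if stable_number s P = stable_number s N then tie_sign s (starts s P) (starts s N)
      else stable_number s N < stable_number s P)"

section \<open>Antisymmetry and monotonicity of the small labels\<close>

definition signed_pair :: "nat set \<Rightarrow> nat set \<Rightarrow> bool" where
  "signed_pair P N \<longleftrightarrow> finite P \<and> finite N \<and> P \<inter> N = {} \<and> P \<union> N \<noteq> {}"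

lemma signed_pair_sym: "signed_pair P N \<Longrightarrow> signed_pair N P"
  by (auto simp: signed_pair_def)

lemma max_stable_number_pos:
  "signed_pair P N \<Longrightarrow> max (stable_number s P) (stable_number s N) \<ge> 1"
  using stable_number_pos[of P s] stable_number_pos[of N s] by (force simp: signed_pair_def)

text \<open>One part is nonempty, so equal stable numbers are both positive and neither part is
  empty.\<close>

lemma close_pair_starts:
  assumes "signed_pair P N" "s \<ge> 2" "stable_number s P = stable_number s N"
  shows "close_pair s (starts s P) (starts s N)"
proof -
  have fin: "finite P" "finite N" and disj: "P \<inter> N = {}" using assms by (auto simp: signed_pair_def)
  have e: "stable_number s {} = 0"
    using stable_number_attained[of "{}" s] by (metis card.empty finite.emptyI subset_empty)
  have "stable_number s P \<ge> 1" "stable_number s N \<ge> 1"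
    using max_stable_number_pos[OF assms(1), of s] assms(3) by auto
  then have "P \<noteq> {}" "N \<noteq> {}" using e by auto
  then show ?thesis
    using starts_nonempty[OF fin(1), of s] starts_nonempty[OF fin(2), of s] starts_subset[of s P]
      starts_subset[of s N] disj starts_close[OF fin(1)] starts_close[OF fin(2)] assms(2)
    unfolding close_pair_def by auto
qed

lemma small_index_sym: "small_index s P N = small_index s N P"
  unfolding small_index_def by (simp add: height_sym[of s "starts s P"] max.commute)

lemma small_sign_swap:
  assumes "signed_pair P N" "s \<ge> 2"
  shows "small_sign s N P \<longleftrightarrow> \<not> small_sign s P N"
  using tie_sign_swap[OF close_pair_starts[OF assms] assms(2)] unfolding small_sign_def by auto

text \<open>The offset \<open>r\<close> reveals which case of \<open>small_index\<close> applies: 1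
  is free for unequal stable numbers because a height is at least 2.\<close>

lemma small_index_decompose:
  assumes "signed_pair P N" "s \<ge> 2"
  obtains r where "small_index s P N = s * (max (stable_number s P) (stable_number s N) - 1) + r"
    "1 \<le> r" "r \<le> s" "r = 1 \<longleftrightarrow> stable_number s P \<noteq> stable_number s N"
    "stable_number s P = stable_number s N \<Longrightarrow> r = height s (starts s P) (starts s N)"
proof (cases "stable_number s P = stable_number s N")
  case True
  have "height s (starts s P) (starts s N) \<ge> 2"
    using height_ge_2 close_pair_starts assms True by blast
  then show thesis
    using that[of "height s (starts s P) (starts s N)"] height_attained[of s "starts s P" "starts s N"] True
    by (simp add: small_index_def)
next
  case False
  then show thesis using that[of 1] assms by (simp add: small_index_def)
qed

lemma small_index_bounds:
  assumes "signed_pair P N" "s \<ge> 2"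
  shows "1 \<le> small_index s P N"
    and "small_index s P N \<le> s * max (stable_number s P) (stable_number s N)"
proof -
  obtain r where r: "small_index s P N = s * (max (stable_number s P) (stable_number s N) - 1) + r"
    "1 \<le> r" "r \<le> s"
    using small_index_decompose[OF assms] by metis
  show "1 \<le> small_index s P N" unfolding r(1) using r(2) by (rule trans_le_add2)
  have bound: "s * (m - 1) + r \<le> s * m" if "m \<ge> 1" for m
    using r(3) that by (cases m) simp_all
  show "small_index s P N \<le> s * max (stable_number s P) (stable_number s N)"
    unfolding r(1) using max_stable_number_pos[OF assms(1)] by (rule bound)
qed

text \<open>Uniqueness of division with remainder, with remainders running from 1 to
  \<open>s\<close>.\<close>

lemma mult_add_cancel:
  fixes a b r t s :: nat
  assumes "s * a + r = s * b + t" "1 \<le> r" "r \<le> s" "1 \<le> t" "t \<le> s"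
  shows "a = b" "r = t"
proof -
  have "\<not> a < b"
  proof
    assume "a < b"
    then have "s * Suc a \<le> s * b" by (intro mult_le_mono2) simp
    then show False using assms by simp
  qed
  moreover have "\<not> b < a"
  proof
    assume "b < a"
    then have "s * Suc b \<le> s * a" by (intro mult_le_mono2) simp
    then show False using assms by simp
  qed
  ultimately show "a = b" by simp
  then show "r = t" using assms(1) by simp
qed

text \<open>Equal indices fix the larger stable number and the case. In a tie both stable numbers
  are unchanged, so the starting points grow and \<open>tie_sign_mono\<close> applies; otherwise
  \<open>P\<close> already attains the maximum and \<open>P'\<close> must keep it.\<close>

lemma small_sign_mono:
  assumes "signed_pair P N" "signed_pair P' N'" "s \<ge> 2" "P \<subseteq> P'" "N \<subseteq> N'"
    and eq: "small_index s P N = small_index s P' N'" and sg: "small_sign s P N"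
  shows "small_sign s P' N'"
proof -
  let ?a = "stable_number s"
  have le: "?a P \<le> ?a P'" "?a N \<le> ?a N'"
    using assms(2,4,5) by (auto simp: signed_pair_def intro: stable_number_mono)
  obtain r where r: "small_index s P N = s * (max (?a P) (?a N) - 1) + r" "1 \<le> r" "r \<le> s"
    "r = 1 \<longleftrightarrow> ?a P \<noteq> ?a N" "?a P = ?a N \<Longrightarrow> r = height s (starts s P) (starts s N)"
    using small_index_decompose[OF assms(1,3)] by metis
  obtain t where t: "small_index s P' N' = s * (max (?a P') (?a N') - 1) + t" "1 \<le> t" "t \<le> s"
    "t = 1 \<longleftrightarrow> ?a P' \<noteq> ?a N'" "?a P' = ?a N' \<Longrightarrow> t = height s (starts s P') (starts s N')"
    using small_index_decompose[OF assms(2,3)] by metis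
  have "max (?a P) (?a N) - 1 = max (?a P') (?a N') - 1" and rt: "r = t"
    using mult_add_cancel r(1-3) t(1-3) eq by metis+
  then have mx: "max (?a P) (?a N) = max (?a P') (?a N')"
    using max_stable_number_pos[OF assms(1), of s] max_stable_number_pos[OF assms(2), of s] by linarith
  show ?thesis
  proof (cases "?a P = ?a N")
    case True
    then have T': "?a P' = ?a N'" using r(4) t(4) rt by simp
    then have "?a P = ?a P'" "?a N = ?a N'" using mx True by auto
    then have "starts s P \<subseteq> starts s P'" "starts s N \<subseteq> starts s N'"
      using starts_mono[OF assms(4)] starts_mono[OF assms(5)] by blast+
    moreover have "height s (starts s P) (starts s N) = height s (starts s P') (starts s N')"
      using r(5)[OF True] t(5)[OF T'] rt by simp
    moreover have "tie_sign s (starts s P) (starts s N)" using sg True by (simp add: small_sign_def)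
    ultimately have "tie_sign s (starts s P') (starts s N')"
      by (rule tie_sign_mono[OF close_pair_starts[OF assms(1,3) True] close_pair_starts[OF assms(2,3) T'] assms(3)])
    then show ?thesis using T' by (simp add: small_sign_def)
  next
    case False
    then have "?a P' \<noteq> ?a N'" using r(4) t(4) rt by simp
    moreover have "?a N < ?a P" using sg False by (simp add: small_sign_def)
    ultimately show ?thesis using mx le by (auto simp: small_sign_def)
  qed
qed

section \<open>Labels from a proper coloring\<close>

text \<open>Dropping the elements up to \<open>m\<close> lowers all remaining ranks by the same
  number, whose parity only affects the first sign.\<close>

lemma alternating_upper_part:
  assumes "finite L" "alternating e L"
  shows "\<exists>e'. alternating e' {v \<in> L. m < \<bar>v\<bar>}"
proof -
  let ?M = "{v \<in> L. m < \<bar>v\<bar>}"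
  let ?r = "card {w \<in> L. \<bar>w\<bar> \<le> m}"
  have c: "card {w \<in> L. \<bar>w\<bar> < \<bar>v\<bar>} = ?r + card {w \<in> ?M. \<bar>w\<bar> < \<bar>v\<bar>}" if "v \<in> ?M" for v
  proof -
    have "{w \<in> L. \<bar>w\<bar> < \<bar>v\<bar>} = {w \<in> L. \<bar>w\<bar> \<le> m} \<union> {w \<in> ?M. \<bar>w\<bar> < \<bar>v\<bar>}" using that by auto
    moreover have "{w \<in> L. \<bar>w\<bar> \<le> m} \<inter> {w \<in> ?M. \<bar>w\<bar> < \<bar>v\<bar>} = {}" by auto
    ultimately show ?thesis using assms(1) by (simp add: card_Un_disjoint)
  qed
  have "v > 0 \<longleftrightarrow> (even (card {w \<in> ?M. \<bar>w\<bar> < \<bar>v\<bar>}) \<longleftrightarrow> (even ?r \<longleftrightarrow> e))" if "v \<in> ?M" for v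
  proof -
    have "v > 0 \<longleftrightarrow> (even (card {w \<in> L. \<bar>w\<bar> < \<bar>v\<bar>}) \<longleftrightarrow> e)"
      using assms(2) that by (simp add: alternating_def)
    then show ?thesis unfolding c[OF that] even_add by blast
  qed
  then have "alternating (even ?r \<longleftrightarrow> e) ?M" unfolding alternating_def by blast
  then show ?thesis by blast
qed

section \<open>Positive and negative parts of a sign vector\<close>

definition positives :: "int set \<Rightarrow> nat set" where
  "positives x = {i. int i \<in> x}"

text \<open>The negative part is expressed as the positive part of the antipode, so that negation
  merely exchanges the two parts.\<close>

lemma positives_uminus: "i \<in> positives (uminus ` x) \<longleftrightarrow> - int i \<in> x"
  unfolding positives_def by (force simp: image_iff)

lemma positives_mono: "x \<subseteq> y \<Longrightarrow> positives x \<subseteq> positives y"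
  by (auto simp: positives_def)

lemma positives_subset: "signed_set n x \<Longrightarrow> positives x \<subseteq> {1..n}"
  unfolding signed_set_def positives_def by force

lemma signed_set_uminus: "signed_set n x \<Longrightarrow> signed_set n (uminus ` x)"
  unfolding signed_set_def by (auto simp: image_image)

lemma positives_disjoint: "signed_set n x \<Longrightarrow> positives x \<inter> positives (uminus ` x) = {}"
  using positives_uminus[of _ x] by (auto simp: signed_set_def positives_def)

lemma signed_pair_positives:
  assumes "signed_set n x"
  shows "signed_pair (positives x) (positives (uminus ` x))"
proof -
  obtain i where "i \<in> x" using assms by (auto simp: signed_set_def)
  then have "nat \<bar>i\<bar> \<in> positives x \<union> positives (uminus ` x)"
    using positives_uminus[of "nat \<bar>i\<bar>" x] by (cases "i \<ge> 0") (auto simp: positives_def)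
  moreover have "finite (positives x)" "finite (positives (uminus ` x))"
    using assms positives_subset signed_set_uminus finite_subset finite_atLeastAtMost by metis+
  ultimately show ?thesis using positives_disjoint[OF assms] unfolding signed_pair_def by blast
qed

section \<open>The labelling induced by a proper coloring\<close>

locale kneser_coloring =
  fixes n k s :: nat and c :: "nat set \<Rightarrow> nat"
  assumes s: "s \<ge> 2"
    and proper: "proper_coloring (almost_stable_kneser_graph n k s) c"
begin

abbreviation V :: "nat set set" where "V \<equiv> almost_stable_subsets n k s"
abbreviation G :: "nat set graph" where "G \<equiv> almost_stable_kneser_graph n k s"

lemma verts_G: "verts G = V"
  by (simp add: verts_def almost_stable_kneser_graph_def)

lemma finite_V: "finite V"
  using finite_verts_almost_stable_kneser_graph[of n k s] verts_G by simp

lemma color_disjoint: "S \<in> V \<Longrightarrow> T \<in> V \<Longrightarrow> S \<inter> T = {} \<Longrightarrow> c S \<noteq> c T"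
  using proper edges_almost_stable_kneser_graph_iff[of S n k s T] verts_G
  unfolding proper_coloring_def by metis

text \<open>Colors are shifted by one so that 0 can mean that \<open>X\<close> contains no
  vertex.\<close>

definition color_rank :: "nat set \<Rightarrow> nat" where
  "color_rank X = Max (insert 0 ((\<lambda>S. Suc (c S)) ` {S \<in> V. S \<subseteq> X}))"

lemma color_rank_ge: "S \<in> V \<Longrightarrow> S \<subseteq> X \<Longrightarrow> Suc (c S) \<le> color_rank X"
  unfolding color_rank_def using finite_V by (intro Max_ge) auto

lemma color_rank_attained:
  assumes "color_rank X \<noteq> 0"
  shows "\<exists>S\<in>V. S \<subseteq> X \<and> color_rank X = Suc (c S)"
proof -
  have "color_rank X \<in> insert 0 ((\<lambda>S. Suc (c S)) ` {S \<in> V. S \<subseteq> X})"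
    unfolding color_rank_def using finite_V by (intro Max_in) auto
  then show ?thesis using assms by auto
qed

lemma color_rank_mono: "X \<subseteq> Y \<Longrightarrow> color_rank X \<le> color_rank Y"
  using color_rank_attained[of X] color_rank_ge by (cases "color_rank X = 0") fastforce+

text \<open>Vertices inside disjoint sets are adjacent, so they cannot share the largest
  color.\<close>

lemma color_rank_disjoint:
  assumes "P \<inter> N = {}" "color_rank P = color_rank N"
  shows "color_rank P = 0"
proof (rule ccontr)
  assume nz: "color_rank P \<noteq> 0"
  then obtain S where S: "S \<in> V" "S \<subseteq> P" "color_rank P = Suc (c S)" using color_rank_attained by blast
  obtain T where T: "T \<in> V" "T \<subseteq> N" "color_rank N = Suc (c T)"
    using color_rank_attained[of N] nz assms(2) by auto
  have "S \<inter> T = {}" using S(2) T(2) assms(1) by blast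
  then show False using color_disjoint[OF S(1) T(1)] S(3) T(3) assms(2) by simp
qed

lemma stable_number_less:
  assumes "X \<subseteq> {1..n}" "color_rank X = 0"
  shows "stable_number s X \<le> k - 1"
proof (rule ccontr)
  assume "\<not> stable_number s X \<le> k - 1"
  moreover obtain S where S: "S \<subseteq> X" "almost_stable s S" "card S = stable_number s X"
    using stable_number_attained[of X s] assms(1) finite_subset by blast
  ultimately have "k \<le> card S" by simp
  then obtain T where T: "T \<subseteq> S" "card T = k" by (meson obtain_subset_with_card_n)
  then have "T \<in> V"
    using S(1) assms(1) almost_stable_subset[OF S(2) T(1)] unfolding almost_stable_subsets_def by blast
  then show False using color_rank_ge[of T X] T(1) S(1) assms(2) by auto
qed

definition small :: "nat set \<Rightarrow> nat set \<Rightarrow> bool" where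
  "small P N \<longleftrightarrow> color_rank P = 0 \<and> color_rank N = 0"

definition index :: "nat set \<Rightarrow> nat set \<Rightarrow> nat" where
  "index P N = (if small P N then small_index s P N
                else s * (k - 1) + max (color_rank P) (color_rank N))"

definition sign :: "nat set \<Rightarrow> nat set \<Rightarrow> bool" where
  "sign P N \<longleftrightarrow> (if small P N then small_sign s P N else color_rank N < color_rank P)"

lemma index_sym: "index P N = index N P"
  unfolding index_def small_def using small_index_sym[of s P N] by (simp add: max.commute conj_commute)

lemma sign_swap: "signed_pair P N \<Longrightarrow> sign N P \<longleftrightarrow> \<not> sign P N"
  using small_sign_swap[OF _ s, of P N] color_rank_disjoint[of P N]
  unfolding sign_def small_def signed_pair_def by auto

lemma index_pos: "signed_pair P N \<Longrightarrow> index P N \<ge> 1"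
  using small_index_bounds(1)[OF _ s, of P N] unfolding index_def small_def by auto

text \<open>The two kinds of labels occupy disjoint ranges, so sign vectors with equal index are of
  the same kind.\<close>

lemma index_small:
  assumes "signed_pair P N" "P \<subseteq> {1..n}" "N \<subseteq> {1..n}"
  shows "small P N \<longleftrightarrow> index P N \<le> s * (k - 1)"
proof
  assume sm: "small P N"
  have "max (stable_number s P) (stable_number s N) \<le> k - 1"
    using stable_number_less assms(2,3) sm by (simp add: small_def)
  then have "s * max (stable_number s P) (stable_number s N) \<le> s * (k - 1)" by (rule mult_le_mono2)
  then show "index P N \<le> s * (k - 1)"
    using order_trans[OF small_index_bounds(2)[OF assms(1) s]] sm by (simp add: index_def)
next
  assume "index P N \<le> s * (k - 1)"
  then show "small P N" unfolding index_def small_def by (auto split: if_splits)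
qed

text \<open>This is what excludes complementary labels. For large labels the rank of
  \<open>P\<close> is the common maximum, \<open>P'\<close> inherits it, and a tie is impossible by
  properness.\<close>

lemma sign_mono:
  assumes "signed_pair P N" "signed_pair P' N'" "P \<subseteq> P'" "N \<subseteq> N'" "P' \<subseteq> {1..n}" "N' \<subseteq> {1..n}"
    and eq: "index P N = index P' N'" and sg: "sign P N"
  shows "sign P' N'"
proof -
  have sub: "P \<subseteq> {1..n}" "N \<subseteq> {1..n}" using assms(3-6) by auto
  have sm: "small P N \<longleftrightarrow> small P' N'"
    using index_small[OF assms(1) sub] index_small[OF assms(2,5,6)] eq by simp
  show ?thesis
  proof (cases "small P N")
    case True
    then show ?thesis
      using small_sign_mono[OF assms(1,2) s assms(3,4)] sm eq sg unfolding index_def sign_def by simp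
  next
    case False
    have "max (color_rank P) (color_rank N) = max (color_rank P') (color_rank N')"
      using eq False sm by (simp add: index_def)
    moreover have "color_rank N < color_rank P" using sg False by (simp add: sign_def)
    moreover have "color_rank P \<le> color_rank P'" using color_rank_mono assms(3) by blast
    moreover have "color_rank P' \<noteq> color_rank N'"
      using color_rank_disjoint[of P' N'] assms(2) False sm by (auto simp: small_def signed_pair_def)
    ultimately have "color_rank N' < color_rank P'" by linarith
    then show ?thesis using False sm by (simp add: sign_def)
  qed
qed

definition label :: "int set \<Rightarrow> int" where
  "label x = (let P = positives x; N = positives (uminus ` x) in
     if sign P N then int (index P N) else - int (index P N))"

lemma uminus_uminus_image: "uminus ` uminus ` (x :: int set) = x"
  by (simp add: image_image)

lemma abs_label: "\<bar>label x\<bar> = int (index (positives x) (positives (uminus ` x)))"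
  by (simp add: label_def Let_def)

lemma label_pos:
  "signed_set n x \<Longrightarrow> label x > 0 \<longleftrightarrow> sign (positives x) (positives (uminus ` x))"
  using index_pos[OF signed_pair_positives, of n x] by (simp add: label_def Let_def)

sublocale octahedral_labelling n label
proof
  fix x assume x: "signed_set n x"
  show "label (uminus ` x) = - label x"
    unfolding label_def Let_def uminus_uminus_image
    using sign_swap[OF signed_pair_positives[OF x]] index_sym[of "positives x"] by simp
next
  fix x y assume x: "signed_set n x" and y: "signed_set n y" and "x \<subseteq> y"
  let ?P = "positives x" and ?N = "positives (uminus ` x)"
  let ?P' = "positives y" and ?N' = "positives (uminus ` y)"
  note px = signed_pair_positives[OF x] and py = signed_pair_positives[OF y]
  have sub: "?P \<subseteq> ?P'" "?N \<subseteq> ?N'" using \<open>x \<subseteq> y\<close> by (auto intro!: positives_mono)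
  have bd: "?P' \<subseteq> {1..n}" "?N' \<subseteq> {1..n}" using positives_subset signed_set_uminus y by blast+
  show "label x \<noteq> - label y"
  proof
    assume l: "label x = - label y"
    then have "\<bar>label x\<bar> = \<bar>label y\<bar>" by simp
    then have eq: "index ?P ?N = index ?P' ?N'" by (simp add: abs_label)
    have "sign ?P ?N \<longleftrightarrow> sign ?P' ?N'"
    proof (cases "sign ?P ?N")
      case True
      then show ?thesis using sign_mono[OF px py sub bd eq] by blast
    next
      case False
      \<comment> \<open>Monotonicity is available for the positive sign only, so the two parts
        change roles.\<close>
      have eq': "index ?N ?P = index ?N' ?P'" using eq index_sym by metis
      have "sign ?N ?P" using False sign_swap[OF px] by blast
      then have "sign ?N' ?P'"
        by (rule sign_mono[OF signed_pair_sym[OF px] signed_pair_sym[OF py] sub(2,1) bd(2,1) eq'])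
      then show ?thesis using False sign_swap[OF py] by blast
    qed
    then have "label x > 0 \<longleftrightarrow> label y > 0" using label_pos x y by blast
    moreover have "label y \<noteq> 0" using index_pos[OF py] abs_label[of y] by auto
    ultimately show False using l by linarith
  qed
qed

lemma large_label:
  assumes x: "signed_set n x" and large: "int (s * (k - 1)) < \<bar>label x\<bar>"
  shows "\<exists>S\<in>V. S \<subseteq> positives (if label x > 0 then x else uminus ` x) \<and>
           \<bar>label x\<bar> = int (s * (k - 1) + Suc (c S))"
proof -
  let ?P = "positives x" and ?N = "positives (uminus ` x)"
  note p = signed_pair_positives[OF x]
  have "s * (k - 1) < index ?P ?N" using large unfolding abs_label of_nat_less_iff .
  then have ns: "\<not> small ?P ?N"
    using index_small[OF p positives_subset[OF x] positives_subset[OF signed_set_uminus[OF x]]] by linarith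
  then have ix: "index ?P ?N = s * (k - 1) + max (color_rank ?P) (color_rank ?N)"
    and sg: "sign ?P ?N \<longleftrightarrow> color_rank ?N < color_rank ?P"
    by (auto simp: index_def sign_def)
  let ?X = "positives (if label x > 0 then x else uminus ` x)"
  \<comment> \<open>The sign selects the part of larger rank, whose largest color the label
    records.\<close>
  have X: "color_rank ?X = max (color_rank ?P) (color_rank ?N)"
    using sg label_pos[OF x] by (auto simp: max_def)
  then have "color_rank ?X \<noteq> 0" using ns unfolding small_def by auto
  then obtain S where S: "S \<in> V" "S \<subseteq> ?X" "color_rank ?X = Suc (c S)"
    using color_rank_attained by blast
  have "\<bar>label x\<bar> = int (s * (k - 1) + Suc (c S))" unfolding abs_label ix X[symmetric] S(3) ..
  then show ?thesis using S(1,2) by blast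
qed

section \<open>From an alternating chain to a colorful neighborhood\<close>

lemma closed_neighborhood_colors:
  assumes T: "T \<in> V" "T \<subseteq> Y" and "X \<inter> Y = {}"
    and W: "\<forall>w\<in>W. \<exists>S\<in>V. S \<subseteq> X \<and> \<bar>w\<bar> = int (m + Suc (c S))" and inj: "inj_on abs W"
  shows "Suc (card W) \<le> card (c ` closed_neighborhood G T)"
proof -
  let ?F = "{S \<in> V. S \<subseteq> X}"
  have fin: "finite ?F" using finite_V by simp
  have "abs ` W \<subseteq> (\<lambda>a. int (m + Suc a)) ` c ` ?F" using W by auto
  then have "card (abs ` W) \<le> card (c ` ?F)"
    using fin surj_card_le[of "c ` ?F"] by blast
  then have W_le: "card W \<le> card (c ` ?F)" using inj by (simp add: card_image)
  have "c T \<notin> c ` ?F"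
  proof
    assume "c T \<in> c ` ?F"
    then obtain S where "S \<in> V" "S \<subseteq> X" "c T = c S" by auto
    then show False using color_disjoint[of S T] T assms(3) by auto
  qed
  then have card_insert: "card (insert (c T) (c ` ?F)) = Suc (card (c ` ?F))" using fin by simp
  have sub: "insert (c T) (c ` ?F) \<subseteq> c ` closed_neighborhood G T"
  proof -
    have "{T, S} \<in> edges G" if "S \<in> ?F" for S
      using that T assms(3) edges_almost_stable_kneser_graph_iff[of T n k s S] verts_G by auto
    then show ?thesis unfolding closed_neighborhood_def verts_G by blast
  qed
  have "card (insert (c T) (c ` ?F)) \<le> card (c ` closed_neighborhood G T)"
    using finite_V by (intro card_mono[OF _ sub]) (simp add: closed_neighborhood_def verts_G)
  then show ?thesis using W_le card_insert by linarith
qed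

theorem exists_colorful_neighborhood:
  assumes "2 \<le> n - s * (k - 1)"
  shows "\<exists>T\<in>V. Suc (Suc (n - s * (k - 1)) div 2) \<le> card (c ` closed_neighborhood G T)"
proof -
  define m where "m = s * (k - 1)"
  have t: "2 \<le> n - m" using assms by (simp add: m_def)
  have "full_alt n True \<noteq> {}" using odd_card_full_alt[of n] by (metis card.empty even_zero order_refl)
  then obtain \<sigma> where \<sigma>: "\<sigma> \<in> flags n" and card_L: "card (labels \<sigma> {1..n}) = n"
    and alt_L: "alternating True (labels \<sigma> {1..n})"
    by (auto simp: full_alt_def)
  define L where "L = labels \<sigma> {1..n}"
  define M where "M = {v \<in> L. int m < \<bar>v\<bar>}"
  have fin: "finite L" "finite M" by (simp_all add: L_def M_def labels_def)
  have abs_L: "inj_on abs L" "0 \<notin> L"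
    using labels_abs_inj[OF \<sigma> order_refl order_refl] by (simp_all add: L_def)
  have abs_sub: "inj_on abs W" if "W \<subseteq> L" for W using abs_L(1) that by (rule inj_on_subset)
  have M_L: "M \<subseteq> L" by (auto simp: M_def)
  obtain e where alt: "alternating e M"
    using alternating_upper_part[OF fin(1), of True "int m"] alt_L unfolding L_def M_def by blast
  \<comment> \<open>Labels are nonzero with distinct absolute values, so at most \<open>m\<close> of
    them fit below the threshold.\<close>
  have "card {v \<in> L. \<not> int m < \<bar>v\<bar>} \<le> m"
  proof -
    have "card (abs ` {v \<in> L. \<not> int m < \<bar>v\<bar>}) \<le> card {1..int m}"
    proof (rule card_mono[OF _ image_subsetI])
      fix v assume v: "v \<in> {v \<in> L. \<not> int m < \<bar>v\<bar>}"
      then have "v \<noteq> 0" using abs_L(2) by auto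
      then show "\<bar>v\<bar> \<in> {1..int m}" using v by auto
    qed simp
    moreover have "inj_on abs {v \<in> L. \<not> int m < \<bar>v\<bar>}" by (rule abs_sub) auto
    ultimately show ?thesis by (simp add: card_image)
  qed
  moreover have "card L = card M + card {v \<in> L. \<not> int m < \<bar>v\<bar>}"
  proof -
    have "L = M \<union> {v \<in> L. \<not> int m < \<bar>v\<bar>}" by (auto simp: M_def)
    moreover have "M \<inter> {v \<in> L. \<not> int m < \<bar>v\<bar>} = {}" by (auto simp: M_def)
    ultimately show ?thesis using fin by (metis (no_types, lifting) card_Un_disjoint finite_Un)
  qed
  ultimately have card_M: "n - m \<le> card M" using card_L by (simp add: L_def)

  \<comment> \<open>The last set of the chain contains all earlier ones, so vertices found at
    different steps with opposite signs lie in the disjoint sets \<open>?X\<close> and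
    \<open>?Y\<close>.\<close>
  let ?X = "positives (set \<sigma>)" and ?Y = "positives (uminus ` set \<sigma>)"
  have "signed_set n (set \<sigma>)"
    using signed_set_take[OF \<sigma> order_refl, of n] length_flags[OF \<sigma>] t by simp
  then have disj: "?X \<inter> ?Y = {}" by (rule positives_disjoint)
  have vertex: "\<exists>S\<in>V. S \<subseteq> (if v > 0 then ?X else ?Y) \<and> \<bar>v\<bar> = int (m + Suc (c S))" if "v \<in> M" for v
  proof -
    obtain j where j: "j \<in> {1..n}" "v = label (set (take j \<sigma>))"
      using \<open>v \<in> M\<close> by (auto simp: M_def L_def labels_def)
    let ?x = "set (take j \<sigma>)"
    have "signed_set n ?x" using signed_set_take[OF \<sigma> order_refl] j by simp
    then obtain S where S: "S \<in> V" "S \<subseteq> positives (if v > 0 then ?x else uminus ` ?x)"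
        "\<bar>v\<bar> = int (m + Suc (c S))"
      using large_label[of ?x] \<open>v \<in> M\<close> unfolding M_def j(2) m_def by blast
    have "positives ?x \<subseteq> ?X" "positives (uminus ` ?x) \<subseteq> ?Y"
      by (intro positives_mono image_mono set_take_subset)+
    then have "S \<subseteq> (if v > 0 then ?X else ?Y)" using S(2) by (auto split: if_splits)
    then show ?thesis using S by blast
  qed
  define Mp Mn where "Mp = {v \<in> M. v > 0}" and "Mn = {v \<in> M. \<not> v > 0}"
  have Mp: "\<forall>w\<in>Mp. \<exists>S\<in>V. S \<subseteq> ?X \<and> \<bar>w\<bar> = int (m + Suc (c S))"
  proof
    fix w assume "w \<in> Mp"
    then show "\<exists>S\<in>V. S \<subseteq> ?X \<and> \<bar>w\<bar> = int (m + Suc (c S))"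
      using vertex[of w] by (simp add: Mp_def)
  qed
  have Mn: "\<forall>w\<in>Mn. \<exists>S\<in>V. S \<subseteq> ?Y \<and> \<bar>w\<bar> = int (m + Suc (c S))"
  proof
    fix w assume "w \<in> Mn"
    then show "\<exists>S\<in>V. S \<subseteq> ?Y \<and> \<bar>w\<bar> = int (m + Suc (c S))"
      using vertex[of w] by (simp add: Mn_def)
  qed
  have inj: "inj_on abs Mp" "inj_on abs Mn"
    using M_L by (auto intro!: abs_sub simp: Mp_def Mn_def)
  have "card M = card Mp + card Mn"
  proof -
    have "M = Mp \<union> Mn" "Mp \<inter> Mn = {}" by (auto simp: Mp_def Mn_def)
    then show ?thesis using fin(2) by (metis card_Un_disjoint finite_Un)
  qed
  moreover have "card Mp = (if e then Suc (card M) div 2 else card M div 2)"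
    unfolding Mp_def using card_pos_alternating[OF fin(2) abs_sub[OF M_L] alt] .
  \<comment> \<open>The larger sign class has half of \<open>M\<close>, rounded up; the other is
    nonempty because \<open>M\<close> has at least two elements, and it supplies the vertex
    \<open>T\<close>.\<close>
  ultimately have "Suc (card M) div 2 \<le> card Mp \<and> 1 \<le> card Mn \<or> Suc (card M) div 2 \<le> card Mn \<and> 1 \<le> card Mp"
    using card_M t by (cases e) auto
  then have "Suc (n - m) div 2 \<le> card Mp \<and> Mn \<noteq> {} \<or> Suc (n - m) div 2 \<le> card Mn \<and> Mp \<noteq> {}"
    using card_M div_le_mono[of "Suc (n - m)" "Suc (card M)" 2] by force
  then show ?thesis
  proof (elim disjE conjE)
    assume half: "Suc (n - m) div 2 \<le> card Mp" and "Mn \<noteq> {}"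
    then obtain T where T: "T \<in> V" "T \<subseteq> ?Y" using Mn by blast
    have "Suc (card Mp) \<le> card (c ` closed_neighborhood G T)"
      using closed_neighborhood_colors[OF T disj Mp inj(1)] .
    then show ?thesis using T(1) half unfolding m_def by (intro bexI[of _ T]) linarith+
  next
    assume half: "Suc (n - m) div 2 \<le> card Mn" and "Mp \<noteq> {}"
    then obtain T where T: "T \<in> V" "T \<subseteq> ?X" using Mp by blast
    have "?Y \<inter> ?X = {}" using disj by blast
    then have "Suc (card Mn) \<le> card (c ` closed_neighborhood G T)"
      using closed_neighborhood_colors[OF T _ Mn inj(2)] by blast
    then show ?thesis using T(1) half unfolding m_def by (intro bexI[of _ T]) linarith+
  qed
qed

end

theorem theorem2p7:
  fixes n k s :: nat
  assumes "n \<ge> 1" and "k \<ge> 2" and "s \<ge> 2" and "n \<ge> s * k"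
  shows "int (local_chromatic_number (almost_stable_kneser_graph n k s))
           \<ge> \<lceil>(real n - real s * (real k - 1)) / 2\<rceil> + 1"
proof -
  let ?G = "almost_stable_kneser_graph n k s"
  let ?t = "n - s * (k - 1)"
  have fin: "finite (verts ?G)" by (rule finite_verts_almost_stable_kneser_graph)
  have "simple_graph ?G" using assms(2) by (intro simple_graph_almost_stable_kneser_graph) simp
  then obtain c where c: "proper_coloring ?G c"
    and max: "local_chromatic_number ?G = Max ((\<lambda>v. card (c ` closed_neighborhood ?G v)) ` verts ?G)"
    using local_chromatic_number_attained[OF fin] by blast
  interpret kneser_coloring n k s c
    using assms(3) c by unfold_locales
  \<comment> \<open>Hence \<open>?t\<close> is at least \<open>s\<close>, and so at least 2.\<close>
  have sk: "s * k = s + s * (k - 1)" using assms(2) by (cases k) auto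
  then have "2 \<le> ?t" using assms(3,4) by simp
  then obtain T where T: "T \<in> V" "Suc (Suc ?t div 2) \<le> card (c ` closed_neighborhood ?G T)"
    using exists_colorful_neighborhood by blast
  have "card (c ` closed_neighborhood ?G T) \<le> local_chromatic_number ?G"
    unfolding max using fin T(1) verts_G by (intro Max_ge) auto
  then have bound: "Suc (Suc ?t div 2) \<le> local_chromatic_number ?G" using T(2) by simp
  have "real n - real s * (real k - 1) = real ?t"
    using assms(2,4) sk by (simp add: of_nat_diff)
  \<comment> \<open>Rounding up is expressed by natural division of the successor.\<close>
  moreover have "\<lceil>real ?t / 2\<rceil> \<le> int (Suc ?t div 2)"
  proof -
    have "?t \<le> 2 * (Suc ?t div 2)" by linarith
    then have "real ?t \<le> 2 * real (Suc ?t div 2)" by (metis of_nat_le_iff of_nat_mult of_nat_numeral)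
    then show ?thesis by (simp add: ceiling_le_iff)
  qed
  ultimately show ?thesis using bound by simp
qed

end
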